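(* Let $H$ be a Hilbert $C^*$-module and $Q\in\mathcal{L}(H)$ an idempotent. Then there exist operators $T,V\in\mathcal{L}(H)$ such that $$s(Q)=TT^\dagger=VV^*\quad\text{and}\quad P_{\mathcal{R}(Q)}=T^\dagger T=V^*V.$$
   Context: $H$ is a Hilbert module over a $C^*$-algebra, $\mathcal{L}(H)$ the adjointable operators. For $T\in\mathcal{L}(H)$, $|T|=(T^*T)^{1/2}$, and $T^\dagger$ denotes the Moore–Penrose inverse of $T$: the unique $X\in\mathcal{L}(H)$ with $TXT=T$, $XTX=X$, $(TX)^*=TX$, $(XT)^*=XT$ (it exists iff $\mathcal{R}(T)$ is closed). For an idempotent $Q$, $P_{\mathcal{R}(Q)}$ is the projection onto $\mathcal{R}(Q)$, and the matched projection is $m(Q)=\tfrac12(|Q^*|+Q^* )|Q^*|^\dagger(|Q^*|+I)^{-1}(|Q^*|+Q)$. The supplementary projection of $Q$ is $s(Q)=m(2P_{\mathcal{R}(Q)}-Q)$ (note $2P_{\mathcal{R}(Q)}-Q$ is an idempotent). *)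

theory Defs
  imports Complex_Main
begin

class cplx_vector = real_vector +
  fixes scaleC :: "complex \<Rightarrow> 'a \<Rightarrow> 'a"
  assumes scaleC_add_right: "scaleC c (x + y) = scaleC c x + scaleC c y"
    and scaleC_add_left: "scaleC (c + d) x = scaleC c x + scaleC d x"
    and scaleC_scaleC: "scaleC c (scaleC d x) = scaleC (c * d) x"
    and scaleC_one: "scaleC 1 x = x"
    and scaleR_scaleC: "scaleR r x = scaleC (complex_of_real r) x"

class cstar_algebra = cplx_vector + real_normed_algebra + banach +
  fixes star :: "'a \<Rightarrow> 'a"
  assumes norm_scaleC: "norm (scaleC c x) = cmod c * norm x"
    and mult_scaleC_left: "scaleC c x * y = scaleC c (x * y)"
    and mult_scaleC_right: "x * scaleC c y = scaleC c (x * y)"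
    and star_star: "star (star x) = x"
    and star_add: "star (x + y) = star x + star y"
    and star_mult: "star (x * y) = star y * star x"
    and star_scaleC: "star (scaleC c x) = scaleC (cnj c) (star x)"
    and cstar_identity: "norm (star x * x) = norm x ^ 2"

definition cstar_positive :: "'a::cstar_algebra \<Rightarrow> bool" where
  "cstar_positive a \<longleftrightarrow> (\<exists>b. a = star b * b)"

definition hnorm :: "('h \<Rightarrow> 'h \<Rightarrow> 'a::cstar_algebra) \<Rightarrow> 'h \<Rightarrow> real" where
  "hnorm inn x = sqrt (norm (inn x x))"

locale hilbert_cstar_module =
  fixes act :: "'h::cplx_vector \<Rightarrow> 'a::cstar_algebra \<Rightarrow> 'h"
    and inn :: "'h \<Rightarrow> 'h \<Rightarrow> 'a"
  assumes act_add_left: "act (x + y) a = act x a + act y a"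
    and act_add_right: "act x (a + b) = act x a + act x b"
    and act_mult: "act x (a * b) = act (act x a) b"
    and act_scaleC_left: "act (scaleC c x) a = scaleC c (act x a)"
    and act_scaleC_right: "act x (scaleC c a) = scaleC c (act x a)"
    and inn_add_right: "inn x (y + z) = inn x y + inn x z"
    and inn_scaleC_right: "inn x (scaleC c y) = scaleC c (inn x y)"
    and inn_act_right: "inn x (act y a) = inn x y * a"
    and inn_star: "star (inn x y) = inn y x"
    and inn_pos: "cstar_positive (inn x x)"
    and inn_definite: "inn x x = 0 \<Longrightarrow> x = 0"
    and complete: "(\<forall>e>0. \<exists>N. \<forall>m\<ge>N. \<forall>n\<ge>N. hnorm inn (X m - X n) < e)
                   \<Longrightarrow> \<exists>L. (\<lambda>n. hnorm inn (X n - L)) \<longlonglongrightarrow> 0"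

definition adjointable :: "('h \<Rightarrow> 'h \<Rightarrow> 'a) \<Rightarrow> ('h \<Rightarrow> 'h) \<Rightarrow> bool" where
  "adjointable inn T \<longleftrightarrow> (\<exists>S. \<forall>x y. inn (T x) y = inn x (S y))"

definition adj :: "('h \<Rightarrow> 'h \<Rightarrow> 'a) \<Rightarrow> ('h \<Rightarrow> 'h) \<Rightarrow> ('h \<Rightarrow> 'h)" where
  "adj inn T = (SOME S. \<forall>x y. inn (T x) y = inn x (S y))"

definition pos_op :: "('h \<Rightarrow> 'h \<Rightarrow> 'a) \<Rightarrow> ('h \<Rightarrow> 'h) \<Rightarrow> bool" where
  "pos_op inn T \<longleftrightarrow> adjointable inn T \<and> (\<exists>S. adjointable inn S \<and> T = adj inn S \<circ> S)"

definition op_sqrt :: "('h \<Rightarrow> 'h \<Rightarrow> 'a) \<Rightarrow> ('h \<Rightarrow> 'h) \<Rightarrow> ('h \<Rightarrow> 'h)" where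
  "op_sqrt inn T = (THE R. pos_op inn R \<and> R \<circ> R = T)"

definition op_abs :: "('h \<Rightarrow> 'h \<Rightarrow> 'a) \<Rightarrow> ('h \<Rightarrow> 'h) \<Rightarrow> ('h \<Rightarrow> 'h)" where
  "op_abs inn T = op_sqrt inn (adj inn T \<circ> T)"

definition is_mp_inverse :: "('h \<Rightarrow> 'h \<Rightarrow> 'a) \<Rightarrow> ('h \<Rightarrow> 'h) \<Rightarrow> ('h \<Rightarrow> 'h) \<Rightarrow> bool" where
  "is_mp_inverse inn T X \<longleftrightarrow> adjointable inn X \<and> T \<circ> X \<circ> T = T \<and> X \<circ> T \<circ> X = X
     \<and> adj inn (T \<circ> X) = T \<circ> X \<and> adj inn (X \<circ> T) = X \<circ> T"

text \<open>Moore--Penrose inverse T^dagger (meaningful when it exists).\<close>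
definition mp_inv :: "('h \<Rightarrow> 'h \<Rightarrow> 'a) \<Rightarrow> ('h \<Rightarrow> 'h) \<Rightarrow> ('h \<Rightarrow> 'h)" where
  "mp_inv inn T = (THE X. is_mp_inverse inn T X)"

definition op_inverse :: "('h \<Rightarrow> 'h \<Rightarrow> 'a) \<Rightarrow> ('h \<Rightarrow> 'h) \<Rightarrow> ('h \<Rightarrow> 'h)" where
  "op_inverse inn A = (THE X. adjointable inn X \<and> X \<circ> A = id \<and> A \<circ> X = id)"

definition range_proj :: "('h \<Rightarrow> 'h \<Rightarrow> 'a) \<Rightarrow> ('h \<Rightarrow> 'h) \<Rightarrow> ('h \<Rightarrow> 'h)" where
  "range_proj inn Q = (THE P. adjointable inn P \<and> P \<circ> P = P \<and> adj inn P = P \<and> range P = range Q)"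

definition matched_proj :: "('h::cplx_vector \<Rightarrow> 'h \<Rightarrow> 'a) \<Rightarrow> ('h \<Rightarrow> 'h) \<Rightarrow> ('h \<Rightarrow> 'h)" where
  "matched_proj inn Q =
    (let A = op_abs inn (adj inn Q) in
       (\<lambda>x. scaleC (1/2) x) \<circ> (\<lambda>x. A x + adj inn Q x) \<circ> mp_inv inn A
         \<circ> op_inverse inn (\<lambda>x. A x + x) \<circ> (\<lambda>x. A x + Q x))"

definition supp_proj :: "('h::cplx_vector \<Rightarrow> 'h \<Rightarrow> 'a) \<Rightarrow> ('h \<Rightarrow> 'h) \<Rightarrow> ('h \<Rightarrow> 'h)" where
  "supp_proj inn Q = matched_proj inn (\<lambda>x. scaleC 2 (range_proj inn Q x) - Q x)"

end

theory Submission
  imports Defs "HOL-Analysis.Urysohn"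
begin

text \<open>
  Write \<open>P\<close> for the projection onto the range of \<open>Q\<close>, \<open>R = 2P - Q\<close>, \<open>A = |R\<^sup>*|\<close> and \<open>W = A + R\<close>. Since
  \<open>R A = A\<close>, one finds \<open>W W\<^sup>* = 2 A (A + 1)\<close>, so that \<open>m(R) = W\<^sup>* (W W\<^sup>*)\<^sup>\<dagger> W\<close> is the projection onto the range
  of \<open>W\<^sup>*\<close> and \<open>V = W\<^sup>* ((W W\<^sup>*)\<^sup>\<dagger>)\<^sup>1\<^sup>/\<^sup>2\<close> satisfies \<open>V V\<^sup>* = m(R)\<close>, \<open>V\<^sup>* V = P\<close>. As \<open>V\<close> is a partial isometry,
  \<open>V\<^sup>\<dagger> = V\<^sup>*\<close> and \<open>T = V\<close> works as well.

  Square roots, their uniqueness, the invertibility of \<open>1 + a\<^sup>* a\<close>, and the Cauchy-Schwarz inequality of the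
  module rest on the theory of positive elements of a \<open>C\<^sup>*\<close>-algebra, obtained here without spectra:
  an element is called positive when \<open>\<parallel>t - T\<parallel> \<le> t\<close> for some \<open>t\<close>, the square root of \<open>1 - X\<close> comes from the
  contraction \<open>Y \<mapsto> (X + Y\<^sup>2) / 2\<close>, and positivity of \<open>T\<^sup>* T\<close> follows the argument of Kelley and Vaught.
\<close>

section \<open>Linear maps\<close>

lemma scaleC_zero_right [simp]: "scaleC c (0::'a::cplx_vector) = 0"
  by (metis add_cancel_right_right scaleC_add_right)

lemma scaleC_zero_left [simp]: "scaleC 0 (x::'a::cplx_vector) = 0"
  by (metis add_cancel_right_right scaleC_add_left)

lemma scaleC_minus_right: "scaleC c (- x) = - scaleC c (x::'a::cplx_vector)"
  by (metis add.right_inverse add_eq_0_iff scaleC_add_right scaleC_zero_right)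

lemma scaleC_minus_left: "scaleC (- c) x = - scaleC c (x::'a::cplx_vector)"
  by (metis add.right_inverse add_eq_0_iff scaleC_add_left scaleC_zero_left)

lemma scaleC_diff_right: "scaleC c (x - y) = scaleC c x - scaleC c (y::'a::cplx_vector)"
  using scaleC_add_right[of c x "- y"] by (simp add: scaleC_minus_right)

lemma norm_star: "norm (star x) = norm (x::'a::cstar_algebra)"
proof -
  have le: "norm y \<le> norm (star y)" for y :: 'a
  proof (cases "y = 0")
    case False
    have "norm y * norm y \<le> norm (star y) * norm y"
      using cstar_identity[of y] norm_mult_ineq[of "star y" y] by (simp add: power2_eq_square)
    then show ?thesis using False by simp
  qed simp
  show ?thesis using le[of x] le[of "star x"] by (simp add: star_star)
qed

text \<open>Adjointable maps are linear, so computing in the ring of all linear maps loses nothing;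
  this type does not depend on the inner product.\<close>

typedef (overloaded) 'h clin =
  "{T :: 'h::cplx_vector \<Rightarrow> 'h. (\<forall>x y. T (x + y) = T x + T y) \<and> (\<forall>c x. T (scaleC c x) = scaleC c (T x))}"
  morphisms ap Clin
  by (rule exI[of _ "\<lambda>x. x"]) simp

setup_lifting type_definition_clin

lemma clin_eqI: "(\<And>x. ap S x = ap T x) \<Longrightarrow> S = T"
  by (metis ap_inject ext)

text \<open>On the zero module \<open>0 = 1\<close>, so \<open>ring_1\<close> and
  \<open>real_algebra_1\<close> are out of reach; \<open>monoid_mult\<close> still provides the
  unit.\<close>

instantiation clin :: (cplx_vector) "{ring, monoid_mult, cplx_vector, real_algebra}"
begin

lift_definition zero_clin :: "'a clin" is "\<lambda>x. 0" by simp
lift_definition one_clin :: "'a clin" is "\<lambda>x. x" by simp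
lift_definition plus_clin :: "'a clin \<Rightarrow> 'a clin \<Rightarrow> 'a clin" is "\<lambda>S T x. S x + T x"
  by (simp add: scaleC_add_right)
lift_definition minus_clin :: "'a clin \<Rightarrow> 'a clin \<Rightarrow> 'a clin" is "\<lambda>S T x. S x - T x"
  by (simp add: scaleC_diff_right)
lift_definition uminus_clin :: "'a clin \<Rightarrow> 'a clin" is "\<lambda>T x. - T x"
  by (simp add: scaleC_minus_right)
lift_definition times_clin :: "'a clin \<Rightarrow> 'a clin \<Rightarrow> 'a clin" is "\<lambda>S T x. S (T x)"
  by simp
lift_definition scaleC_clin :: "complex \<Rightarrow> 'a clin \<Rightarrow> 'a clin" is "\<lambda>c T x. scaleC c (T x)"
  by (simp add: scaleC_add_right scaleC_scaleC mult.commute)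
definition scaleR_clin :: "real \<Rightarrow> 'a clin \<Rightarrow> 'a clin"
  where "scaleR_clin r T = scaleC (complex_of_real r) T"

lemmas clin_ap = zero_clin.rep_eq one_clin.rep_eq plus_clin.rep_eq minus_clin.rep_eq
  uminus_clin.rep_eq times_clin.rep_eq scaleC_clin.rep_eq

lemma ap_add: "ap T (x + y) = ap T x + ap T y"
  and ap_scaleC: "ap T (scaleC c x) = scaleC c (ap T x)"
  using ap[of T] by auto

instance
  by standard
    (auto intro!: clin_eqI simp: clin_ap ap_add ap_scaleC scaleR_clin_def scaleC_add_right
      scaleC_add_left scaleC_scaleC scaleC_one)

end

lemma ap_scaleR: "ap (scaleR r T) x = scaleR r (ap T x)"
  by (simp add: scaleR_clin_def clin_ap scaleR_scaleC)

lemma ap_scaleR_right: "ap T (scaleR r x) = scaleR r (ap T x)"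
  by (simp add: ap_scaleC scaleR_scaleC)

lemma ap_zero [simp]: "ap T 0 = 0"
  by (metis ap_add add_cancel_right_right)

lemma mult_scaleC_clin_left: "scaleC c S * T = scaleC c (S * T :: 'h::cplx_vector clin)"
  and mult_scaleC_clin_right: "S * scaleC c T = scaleC c (S * T :: 'h::cplx_vector clin)"
  by (auto intro!: clin_eqI simp: clin_ap ap_scaleC)

section \<open>Bounded operators and their limits\<close>

locale sesquilinear =
  fixes inn :: "'h::cplx_vector \<Rightarrow> 'h \<Rightarrow> 'a::cstar_algebra"
  assumes inn_add_right: "inn x (y + z) = inn x y + inn x z"
    and inn_scaleC_right: "inn x (scaleC c y) = scaleC c (inn x y)"
    and inn_star: "star (inn x y) = inn y x"
    and inn_definite: "inn x x = 0 \<Longrightarrow> x = 0"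
begin

lemma inn_add_left: "inn (x + y) z = inn x z + inn y z"
  by (metis inn_add_right inn_star star_add)

lemma inn_scaleC_left: "inn (scaleC c x) y = scaleC (cnj c) (inn x y)"
  by (metis inn_scaleC_right inn_star star_scaleC)

lemma inn_zero_right [simp]: "inn x 0 = 0"
  by (metis inn_add_right add_cancel_right_right)

lemma inn_zero_left [simp]: "inn 0 x = 0"
  by (metis inn_add_left add_cancel_right_right)

lemma inn_minus_right: "inn x (- y) = - inn x y"
  by (metis inn_add_right inn_zero_right add.right_inverse add_eq_0_iff)

lemma inn_minus_left: "inn (- x) y = - inn x y"
  by (metis inn_add_left inn_zero_left add.right_inverse add_eq_0_iff)

lemma inn_diff_right: "inn x (y - z) = inn x y - inn x z"
  using inn_add_right[of x y "- z"] by (simp add: inn_minus_right)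

lemma inn_diff_left: "inn (x - y) z = inn x z - inn y z"
  using inn_add_left[of x "- y" z] by (simp add: inn_minus_left)

lemma inn_eqI: "(\<And>y. inn x y = inn z y) \<Longrightarrow> x = z"
  using inn_definite[of "x - z"] by (simp add: inn_diff_left)

end

text \<open>Positivity of the inner product is left out on purpose: over itself, with
  \<open>\<langle>x, y\<rangle> = x\<^sup>* y\<close>, a \<open>C\<^sup>*\<close>-algebra satisfies these assumptions trivially, so that the theory of
  positive elements below serves both for the coefficient algebra and for the operators on a
  Hilbert module.\<close>

locale prehilbert = sesquilinear inn
  for inn :: "'h::cplx_vector \<Rightarrow> 'h \<Rightarrow> 'a::cstar_algebra" +
  assumes complete: "(\<forall>e>0. \<exists>N. \<forall>m\<ge>N. \<forall>n\<ge>N. hnorm inn (X m - X n) < e)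
                   \<Longrightarrow> \<exists>L. (\<lambda>n. hnorm inn (X n - L)) \<longlonglongrightarrow> 0"
    and cauchy_schwarz: "norm (inn x y) \<le> hnorm inn x * hnorm inn y"
begin

abbreviation nrm :: "'h \<Rightarrow> real" where "nrm \<equiv> hnorm inn"

lemma nrm_nonneg [simp]: "0 \<le> nrm x"
  by (simp add: hnorm_def)

lemma nrm_square: "(nrm x)\<^sup>2 = norm (inn x x)"
  by (simp add: hnorm_def)

lemma nrm_zero [simp]: "nrm 0 = 0"
  by (simp add: hnorm_def)

lemma nrm_eq_zero: "nrm x = 0 \<Longrightarrow> x = 0"
  using inn_definite[of x] by (simp add: hnorm_def)

lemma nrm_scaleC: "nrm (scaleC c x) = cmod c * nrm x"
  by (simp add: hnorm_def inn_scaleC_right inn_scaleC_left norm_scaleC real_sqrt_mult)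

lemma nrm_scaleR: "nrm (scaleR r x) = \<bar>r\<bar> * nrm x"
  by (simp add: scaleR_scaleC nrm_scaleC)

lemma nrm_minus: "nrm (- x) = nrm x"
  by (simp add: hnorm_def inn_minus_right inn_minus_left)

lemma nrm_minus_commute: "nrm (x - y) = nrm (y - x)"
  by (metis nrm_minus minus_diff_eq)

lemma nrm_triangle: "nrm (x + y) \<le> nrm x + nrm y"
proof -
  have "(nrm (x + y))\<^sup>2 = norm (inn x x + inn x y + (inn y x + inn y y))"
    by (simp add: nrm_square inn_add_left inn_add_right algebra_simps)
  also have "\<dots> \<le> norm (inn x x) + norm (inn x y) + (norm (inn y x) + norm (inn y y))"
    by (intro norm_triangle_mono order_refl)
  also have "\<dots> \<le> (nrm x)\<^sup>2 + nrm x * nrm y + (nrm y * nrm x + (nrm y)\<^sup>2)"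
    by (simp only: nrm_square) (rule add_mono[OF add_mono[OF order_refl cauchy_schwarz]
        add_mono[OF cauchy_schwarz order_refl]])
  also have "\<dots> = (nrm x + nrm y)\<^sup>2"
    by (simp add: power2_eq_square algebra_simps)
  finally show ?thesis by (rule power2_le_imp_le) simp
qed

lemma nrm_triangle_diff: "nrm (x - z) \<le> nrm (x - y) + nrm (y - z)"
  using nrm_triangle[of "x - y" "y - z"] by simp

text \<open>As a relation it says at once that \<open>T\<close> is adjointable and which map is its
  adjoint, without the choice operator behind \<open>adj\<close>.\<close>

definition has_adj :: "'h clin \<Rightarrow> 'h clin \<Rightarrow> bool" where
  "has_adj T S \<longleftrightarrow> (\<forall>x y. inn (ap T x) y = inn x (ap S y))"

abbreviation sa :: "'h clin \<Rightarrow> bool" where "sa T \<equiv> has_adj T T"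

text \<open>Bounds take the place of an operator norm: the maps of type \<open>clin\<close> may be
  unbounded, and no supremum has to be formed.\<close>

definition opb :: "'h clin \<Rightarrow> real \<Rightarrow> bool" where
  "opb T c \<longleftrightarrow> 0 \<le> c \<and> (\<forall>x. nrm (ap T x) \<le> c * nrm x)"

text \<open>Stands in for membership of \<open>Y\<close> in the closed algebra generated by
  \<open>X\<close>: whatever is built from \<open>X\<close> keeps commuting with everything that
  commutes with \<open>X\<close>. Only adjointable \<open>B\<close> are tested, so that the relation
  survives limits.\<close>

definition bicomm :: "'h clin \<Rightarrow> 'h clin \<Rightarrow> bool" where
  "bicomm X Y \<longleftrightarrow> (\<forall>B B'. has_adj B B' \<longrightarrow> B * X = X * B \<longrightarrow> B * Y = Y * B)"

lemma has_adj_sym: "has_adj T S \<Longrightarrow> has_adj S T"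
  unfolding has_adj_def by (metis inn_star)

lemma has_adj_unique: "has_adj T S \<Longrightarrow> has_adj T S' \<Longrightarrow> S = S'"
  unfolding has_adj_def by (metis inn_eqI inn_star clin_eqI)

lemma has_adj_add: "has_adj T S \<Longrightarrow> has_adj T' S' \<Longrightarrow> has_adj (T + T') (S + S')"
  by (simp add: has_adj_def clin_ap inn_add_left inn_add_right)

lemma has_adj_diff: "has_adj T S \<Longrightarrow> has_adj T' S' \<Longrightarrow> has_adj (T - T') (S - S')"
  by (simp add: has_adj_def clin_ap inn_diff_left inn_diff_right)

lemma has_adj_minus: "has_adj T S \<Longrightarrow> has_adj (- T) (- S)"
  by (simp add: has_adj_def clin_ap inn_minus_left inn_minus_right)

lemma has_adj_mult: "has_adj T S \<Longrightarrow> has_adj T' S' \<Longrightarrow> has_adj (T * T') (S' * S)"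
  by (simp add: has_adj_def clin_ap)

lemma has_adj_scaleC: "has_adj T S \<Longrightarrow> has_adj (scaleC c T) (scaleC (cnj c) S)"
  by (simp add: has_adj_def clin_ap inn_scaleC_left inn_scaleC_right)

lemma has_adj_scaleR: "has_adj T S \<Longrightarrow> has_adj (scaleR r T) (scaleR r S)"
  using has_adj_scaleC[of T S "complex_of_real r"] by (simp add: scaleR_clin_def)

lemma has_adj_one [simp]: "sa 1" and has_adj_zero [simp]: "sa 0"
  by (simp_all add: has_adj_def clin_ap)

lemma sa_mult: "sa S \<Longrightarrow> sa T \<Longrightarrow> S * T = T * S \<Longrightarrow> sa (S * T)"
  by (metis has_adj_mult)

lemmas has_adj_intros = has_adj_add has_adj_diff has_adj_minus has_adj_mult has_adj_scaleR
  has_adj_one has_adj_zero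

lemma opb_nonneg: "opb T c \<Longrightarrow> 0 \<le> c"
  by (simp add: opb_def)

lemma opbD: "opb T c \<Longrightarrow> nrm (ap T x) \<le> c * nrm x"
  by (simp add: opb_def)

lemma opb_mono: "opb T c \<Longrightarrow> c \<le> d \<Longrightarrow> opb T d"
  unfolding opb_def by (meson mult_right_mono nrm_nonneg order_trans)

lemma opb_add: "opb S c \<Longrightarrow> opb T d \<Longrightarrow> opb (S + T) (c + d)"
  unfolding opb_def clin_ap distrib_right
  by (meson add_mono add_nonneg_nonneg nrm_triangle order_trans)

lemma opb_minus: "opb T c \<Longrightarrow> opb (- T) c"
  by (simp add: opb_def clin_ap nrm_minus)

lemma opb_diff: "opb S c \<Longrightarrow> opb T d \<Longrightarrow> opb (S - T) (c + d)"
  using opb_add[of S c "- T" d] opb_minus by simp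

lemma opb_minus_commute: "opb (S - T) c \<Longrightarrow> opb (T - S) c"
  using opb_minus by fastforce

lemma opb_mult:
  assumes "opb S c" "opb T d"
  shows "opb (S * T) (c * d)"
  unfolding opb_def
proof (intro conjI allI)
  show "0 \<le> c * d" using assms by (simp add: opb_def)
  fix x
  have "nrm (ap S (ap T x)) \<le> c * nrm (ap T x)" using assms(1) by (rule opbD)
  also have "\<dots> \<le> c * (d * nrm x)"
    using opbD[OF assms(2)] opb_nonneg[OF assms(1)] by (rule mult_left_mono)
  finally show "nrm (ap (S * T) x) \<le> c * d * nrm x" by (simp add: clin_ap mult.assoc)
qed

lemma opb_scaleR: "opb T c \<Longrightarrow> opb (scaleR r T) (\<bar>r\<bar> * c)"
  by (simp add: opb_def ap_scaleR nrm_scaleR mult.assoc mult_left_mono)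

lemma opb_scaleC: "opb T c \<Longrightarrow> opb (scaleC r T) (cmod r * c)"
  by (simp add: opb_def clin_ap nrm_scaleC mult.assoc mult_left_mono)

lemma opb_one [simp]: "opb 1 1" and opb_zero [simp]: "opb 0 0"
  by (simp_all add: opb_def clin_ap)

lemma opb_adj:
  assumes "has_adj T S" "opb T c"
  shows "opb S c"
  unfolding opb_def
proof (intro conjI allI)
  show "0 \<le> c" using assms by (simp add: opb_def)
  fix x
  have "nrm (ap S x) * nrm (ap S x) = norm (inn (ap T (ap S x)) x)"
    using assms(1) nrm_square[of "ap S x"] by (simp add: power2_eq_square has_adj_def)
  also have "\<dots> \<le> nrm (ap T (ap S x)) * nrm x" by (rule cauchy_schwarz)
  also have "\<dots> \<le> (c * nrm (ap S x)) * nrm x"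
    using assms(2) by (simp add: opb_def mult_right_mono)
  finally have "nrm (ap S x) * nrm (ap S x) \<le> (c * nrm x) * nrm (ap S x)"
    by (simp add: algebra_simps)
  then show "nrm (ap S x) \<le> c * nrm x"
    using \<open>0 \<le> c\<close> nrm_nonneg[of "ap S x"] by (cases "nrm (ap S x) = 0") (auto simp: mult_le_cancel_right)
qed

text \<open>The nontrivial half of the identity between the norm of \<open>S * T\<close> and the
  squared norm of \<open>T\<close>, read off from Cauchy-Schwarz. It extracts bounds of
  \<open>T\<close> from bounds of a product throughout.\<close>

lemma opb_cstar:
  assumes "has_adj T S" "opb (S * T) c"
  shows "opb T (sqrt c)"
  unfolding opb_def
proof (intro conjI allI)
  have c: "0 \<le> c" using assms by (simp add: opb_def)
  then show "0 \<le> sqrt c" by simp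
  fix x
  have "(nrm (ap T x))\<^sup>2 = norm (inn x (ap (S * T) x))"
    using assms(1) by (simp add: nrm_square has_adj_def clin_ap)
  also have "\<dots> \<le> nrm x * nrm (ap (S * T) x)" by (rule cauchy_schwarz)
  also have "\<dots> \<le> nrm x * (c * nrm x)"
    using assms(2) by (simp add: opb_def mult_left_mono)
  also have "\<dots> = (sqrt c * nrm x)\<^sup>2"
    using c by (simp add: power_mult_distrib power2_eq_square)
  finally show "nrm (ap T x) \<le> sqrt c * nrm x"
    using c by (auto intro: power2_le_imp_le)
qed

lemma opb_zero_imp_zero: "opb T 0 \<Longrightarrow> T = 0"
  by (rule clin_eqI) (metis opb_def clin_ap(1) mult_zero_left nrm_eq_zero nrm_nonneg order_antisym)

lemma opb_limit:
  assumes "\<And>d. d > 0 \<Longrightarrow> opb T (c + d)"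
  shows "opb T c"
  unfolding opb_def
proof (intro conjI allI)
  show "0 \<le> c" using assms opb_nonneg by (meson field_le_epsilon)
  fix x
  show "nrm (ap T x) \<le> c * nrm x"
  proof (rule field_le_epsilon)
    fix e :: real assume e: "e > 0"
    have pos: "nrm x + 1 > 0" by (simp add: add_nonneg_pos)
    have "nrm (ap T x) \<le> (c + e / (nrm x + 1)) * nrm x"
      using assms[of "e / (nrm x + 1)"] e pos by (simp add: opb_def)
    also have "\<dots> = c * nrm x + e * (nrm x / (nrm x + 1))" by (simp add: algebra_simps)
    also have "e * (nrm x / (nrm x + 1)) \<le> e * 1"
      using e pos by (intro mult_left_mono) auto
    finally show "nrm (ap T x) \<le> c * nrm x + e" by simp
  qed
qed

lemma sa_square_zero:
  assumes "sa T" "T * T = 0"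
  shows "T = 0"
  using opb_cstar[of T T 0] assms by (simp add: opb_zero_imp_zero)

section \<open>Limits in the operator norm\<close>

definition clin_tendsto :: "(nat \<Rightarrow> 'h clin) \<Rightarrow> 'h clin \<Rightarrow> bool" where
  "clin_tendsto Y Z \<longleftrightarrow> (\<exists>e. e \<longlonglongrightarrow> 0 \<and> (\<forall>n. opb (Z - Y n) (e n)))"

lemma sa_clin_tendsto:
  assumes "clin_tendsto Y Z" "\<And>n. sa (Y n)"
  shows "sa Z"
  unfolding has_adj_def
proof (intro allI)
  fix x y
  obtain e where e: "e \<longlonglongrightarrow> 0" "\<And>n. opb (Z - Y n) (e n)"
    using assms(1) by (auto simp: clin_tendsto_def)
  have "norm (inn (ap Z x) y - inn x (ap Z y)) \<le> e n * (2 * nrm x * nrm y)" for n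
  proof -
    have "inn (ap Z x) y - inn x (ap Z y) = inn (ap (Z - Y n) x) y - inn x (ap (Z - Y n) y)"
      using assms(2)[of n] by (simp add: has_adj_def clin_ap inn_diff_left inn_diff_right)
    also have "norm \<dots> \<le> nrm (ap (Z - Y n) x) * nrm y + nrm x * nrm (ap (Z - Y n) y)"
      by (rule order_trans[OF norm_triangle_ineq4 add_mono[OF cauchy_schwarz cauchy_schwarz]])
    also have "\<dots> \<le> (e n * nrm x) * nrm y + nrm x * (e n * nrm y)"
      using opbD[OF e(2)] by (intro add_mono mult_right_mono mult_left_mono) auto
    finally show ?thesis by (simp add: algebra_simps)
  qed
  moreover have "(\<lambda>n. e n * (2 * nrm x * nrm y)) \<longlonglongrightarrow> 0 * (2 * nrm x * nrm y)"
    by (intro tendsto_intros e)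
  ultimately have "norm (inn (ap Z x) y - inn x (ap Z y)) \<le> 0"
    by (intro LIMSEQ_le_const) auto
  then show "inn (ap Z x) y = inn x (ap Z y)" by simp
qed

text \<open>Inside the inner product \<open>B\<close> moves to the other side as \<open>B'\<close>,
  so the limit passes through although no bound of \<open>B\<close> is at hand: automatic
  boundedness comes only later, from Baire's theorem.\<close>

lemma bicomm_clin_tendsto:
  assumes "clin_tendsto Y Z" "\<And>n. bicomm X (Y n)"
  shows "bicomm X Z"
  unfolding bicomm_def
proof (intro allI impI clin_eqI inn_eqI)
  fix B B' x y
  assume B: "has_adj B B'" "B * X = X * B"
  obtain e where e: "e \<longlonglongrightarrow> 0" "\<And>n. opb (Z - Y n) (e n)"
    using assms(1) by (auto simp: clin_tendsto_def)
  have "norm (inn (ap (B * Z) x) y - inn (ap (Z * B) x) y)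
      \<le> e n * (nrm x * nrm (ap B' y) + nrm (ap B x) * nrm y)" for n
  proof -
    have "B * Y n = Y n * B" using assms(2)[of n] B unfolding bicomm_def by blast
    then have "ap (B * Z - Z * B) x = ap (B * (Z - Y n) - (Z - Y n) * B) x" by (simp add: algebra_simps)
    then have "inn (ap (B * Z) x - ap (Z * B) x) y = inn (ap B (ap (Z - Y n) x) - ap (Z - Y n) (ap B x)) y"
      by (simp only: clin_ap)
    then have "inn (ap (B * Z) x) y - inn (ap (Z * B) x) y
        = inn (ap (Z - Y n) x) (ap B' y) - inn (ap (Z - Y n) (ap B x)) y"
      using B(1) by (simp only: inn_diff_left has_adj_def)
    also have "norm \<dots> \<le> nrm (ap (Z - Y n) x) * nrm (ap B' y) + nrm (ap (Z - Y n) (ap B x)) * nrm y"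
      by (rule order_trans[OF norm_triangle_ineq4 add_mono[OF cauchy_schwarz cauchy_schwarz]])
    also have "\<dots> \<le> (e n * nrm x) * nrm (ap B' y) + (e n * nrm (ap B x)) * nrm y"
      using opbD[OF e(2)] by (intro add_mono mult_right_mono) auto
    finally show ?thesis by (simp add: algebra_simps)
  qed
  moreover have "(\<lambda>n. e n * (nrm x * nrm (ap B' y) + nrm (ap B x) * nrm y))
      \<longlonglongrightarrow> 0 * (nrm x * nrm (ap B' y) + nrm (ap B x) * nrm y)"
    by (intro tendsto_intros e)
  ultimately have "norm (inn (ap (B * Z) x) y - inn (ap (Z * B) x) y) \<le> 0"
    by (intro LIMSEQ_le_const) auto
  then show "inn (ap (B * Z) x) y = inn (ap (Z * B) x) y" by simp
qed

lemma opb_clin_tendsto: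
  assumes "clin_tendsto Y Z" "\<And>n. opb (Y n) c"
  shows "opb Z c"
proof (rule opb_limit)
  fix d :: real assume "d > 0"
  obtain e where e: "e \<longlonglongrightarrow> 0" "\<And>n. opb (Z - Y n) (e n)"
    using assms(1) by (auto simp: clin_tendsto_def)
  then obtain n where "e n < d"
    using \<open>d > 0\<close> order_tendstoD(2)[OF e(1) \<open>d > 0\<close>] by (auto simp: eventually_sequentially)
  then show "opb Z (c + d)"
    using opb_add[OF assms(2)[of n] e(2)[of n]] by (auto intro: opb_mono)
qed

lemma clin_tendsto_unique:
  assumes "clin_tendsto Y Z" "clin_tendsto Y W"
  shows "Z = W"
proof -
  obtain e where e: "e \<longlonglongrightarrow> 0" "\<And>n. opb (Z - Y n) (e n)"
    using assms(1) by (auto simp: clin_tendsto_def)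
  obtain d where d: "d \<longlonglongrightarrow> 0" "\<And>n. opb (W - Y n) (d n)"
    using assms(2) by (auto simp: clin_tendsto_def)
  have "opb (Z - W) (e n + d n)" for n
    using opb_diff[OF e(2)[of n] d(2)[of n]] by simp
  then have le: "nrm (ap (Z - W) x) \<le> (e n + d n) * nrm x" for n x
    by (simp add: opb_def)
  have "nrm (ap (Z - W) x) \<le> 0" for x
  proof (rule LIMSEQ_le_const)
    have "(\<lambda>n. (e n + d n) * nrm x) \<longlonglongrightarrow> (0 + 0) * nrm x"
      by (intro tendsto_intros e d)
    then show "(\<lambda>n. (e n + d n) * nrm x) \<longlonglongrightarrow> 0" by simp
  qed (use le in blast)
  then have "opb (Z - W) 0" by (simp add: opb_def)
  then show ?thesis using opb_zero_imp_zero by fastforce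
qed

lemma nrm_tendsto_unique:
  assumes "(\<lambda>n. nrm (X n - L)) \<longlonglongrightarrow> 0" "(\<lambda>n. nrm (X n - M)) \<longlonglongrightarrow> 0"
  shows "L = M"
proof -
  have "(\<lambda>n. nrm (X n - L) + nrm (X n - M)) \<longlonglongrightarrow> 0 + 0"
    by (intro tendsto_intros assms)
  moreover have "nrm (L - M) \<le> nrm (X n - L) + nrm (X n - M)" for n
    using nrm_triangle_diff[of L M "X n"] by (simp add: nrm_minus_commute)
  ultimately have "nrm (L - M) \<le> 0 + 0"
    by (intro LIMSEQ_le_const) auto
  then show ?thesis using nrm_eq_zero[of "L - M"] by (simp add: order_antisym)
qed

lemma nrm_tendsto_le:
  assumes "(\<lambda>n. nrm (X n - L)) \<longlonglongrightarrow> 0" "\<And>n. n \<ge> N \<Longrightarrow> nrm (X n - y) \<le> c"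
  shows "nrm (L - y) \<le> c"
proof -
  have "(\<lambda>n. nrm (X n - L) + c) \<longlonglongrightarrow> 0 + c"
    by (intro tendsto_intros assms)
  moreover have "nrm (L - y) \<le> nrm (X n - L) + c" if "n \<ge> N" for n
    using nrm_triangle_diff[of L y "X n"] assms(2)[OF that] by (simp add: nrm_minus_commute)
  ultimately have "nrm (L - y) \<le> 0 + c"
    by (intro LIMSEQ_le_const) auto
  then show ?thesis by simp
qed

text \<open>Completeness is assumed for vectors only. The limit is formed pointwise, is linear
  because limits are unique, and is uniform because the tail bound \<open>E n\<close> does not
  depend on the vector.\<close>

lemma geometric_clin_tendsto:
  fixes Y :: "nat \<Rightarrow> 'h clin"
  assumes step: "\<And>n. opb (Y (Suc n) - Y n) (K * r ^ n)" and r: "0 \<le> r" "r < 1"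
  obtains Z where "clin_tendsto Y Z"
proof -
  have K: "0 \<le> K" using opb_nonneg[OF step[of 0]] by simp
  \<comment> \<open>The tail of the geometric series from index \<open>n\<close> on; the differences
    of \<open>E\<close> telescope.\<close>
  define E where "E n = K * r ^ n / (1 - r)" for n
  have E0: "0 \<le> E n" for n using K r by (simp add: E_def)
  have Elim: "E \<longlonglongrightarrow> 0"
  proof -
    have "(\<lambda>n. K * r ^ n / (1 - r)) \<longlonglongrightarrow> K * 0 / (1 - r)"
      using r by (intro tendsto_intros LIMSEQ_realpow_zero) auto
    then show ?thesis by (simp add: E_def[abs_def])
  qed
  have E_step: "K * r ^ m = E m - E (Suc m)" for m
  proof -
    have "E m - E (Suc m) = K * r ^ m * (1 - r) / (1 - r)"
      unfolding E_def diff_divide_distrib[symmetric] by (simp add: right_diff_distrib)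
    then show ?thesis using r by simp
  qed
  have "opb (Y (n + k) - Y n) (E n - E (n + k))" for n k
  proof (induction k)
    case (Suc k)
    have "opb ((Y (Suc (n + k)) - Y (n + k)) + (Y (n + k) - Y n))
        ((E (n + k) - E (Suc (n + k))) + (E n - E (n + k)))"
      by (rule opb_add[OF step[of "n + k", unfolded E_step] Suc])
    then show ?case by simp
  qed simp
  then have tail: "opb (Y (n + k) - Y n) (E n)" for n k
    by (rule opb_mono) (simp add: E0)
  have tail': "nrm (ap (Y m) x - ap (Y n) x) \<le> E n * nrm x" if "m \<ge> n" for m n x
    using opbD[OF tail[of n "m - n"], of x] that by (simp add: clin_ap)
  have "\<exists>L. (\<lambda>n. nrm (ap (Y n) x - L)) \<longlonglongrightarrow> 0" for x
  proof (rule complete, intro allI impI)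
    fix e :: real assume "e > 0"
    have "(\<lambda>n. E n * nrm x) \<longlonglongrightarrow> 0 * nrm x" by (intro tendsto_intros Elim)
    then have "\<forall>\<^sub>F n in sequentially. E n * nrm x < e / 2"
      using \<open>e > 0\<close> by (intro order_tendstoD(2)[of _ "0 * nrm x"]) auto
    then obtain N where N: "E N * nrm x < e / 2"
      by (auto simp: eventually_sequentially)
    have "nrm (ap (Y m) x - ap (Y n) x) < e" if "m \<ge> N" "n \<ge> N" for m n
      using nrm_triangle_diff[of "ap (Y m) x" "ap (Y n) x" "ap (Y N) x"]
        tail'[OF that(1), of x] tail'[OF that(2), of x] N
        nrm_minus_commute[of "ap (Y N) x" "ap (Y n) x"] by linarith
    then show "\<exists>N. \<forall>m\<ge>N. \<forall>n\<ge>N. nrm (ap (Y m) x - ap (Y n) x) < e" by blast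
  qed
  then obtain z where z: "\<And>x. (\<lambda>n. nrm (ap (Y n) x - z x)) \<longlonglongrightarrow> 0" by metis
  have z_add: "z (x + y) = z x + z y" for x y
  proof (rule nrm_tendsto_unique[OF z])
    have "(\<lambda>n. nrm (ap (Y n) x - z x) + nrm (ap (Y n) y - z y)) \<longlonglongrightarrow> 0 + 0"
      by (intro tendsto_intros z)
    then have lim: "(\<lambda>n. nrm (ap (Y n) x - z x) + nrm (ap (Y n) y - z y)) \<longlonglongrightarrow> 0" by simp
    have "nrm (ap (Y n) (x + y) - (z x + z y)) \<le> nrm (ap (Y n) x - z x) + nrm (ap (Y n) y - z y)" for n
      using nrm_triangle[of "ap (Y n) x - z x" "ap (Y n) y - z y"]
      by (simp add: ap_add algebra_simps)
    then show "(\<lambda>n. nrm (ap (Y n) (x + y) - (z x + z y))) \<longlonglongrightarrow> 0"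
      by (intro tendsto_sandwich[OF _ _ tendsto_const lim]) auto
  qed
  have z_scale: "z (scaleC c x) = scaleC c (z x)" for c x
  proof (rule nrm_tendsto_unique[OF z])
    have "(\<lambda>n. cmod c * nrm (ap (Y n) x - z x)) \<longlonglongrightarrow> cmod c * 0"
      by (intro tendsto_intros z)
    then show "(\<lambda>n. nrm (ap (Y n) (scaleC c x) - scaleC c (z x))) \<longlonglongrightarrow> 0"
      by (simp add: ap_scaleC nrm_scaleC flip: scaleC_diff_right)
  qed
  define Z where "Z = Clin z"
  have Z: "ap Z = z" unfolding Z_def by (rule Clin_inverse) (simp add: z_add z_scale)
  have "opb (Z - Y n) (E n)" for n
    using nrm_tendsto_le[OF z tail'] E0 by (simp add: opb_def Z clin_ap)
  then show ?thesis
    using Elim that by (auto simp: clin_tendsto_def)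
qed

text \<open>Banach's fixed point theorem on the closed set described by \<open>Pr\<close>, which
  carries self-adjointness, a bound and bicommutation over to the fixed point.\<close>

lemma contraction_fixpoint:
  fixes F :: "'h clin \<Rightarrow> 'h clin"
  assumes start: "Pr Y0" "opb (F Y0 - Y0) c0"
    and inv: "\<And>Y. Pr Y \<Longrightarrow> Pr (F Y)"
    and contr: "\<And>Y Z c. Pr Y \<Longrightarrow> Pr Z \<Longrightarrow> opb (Y - Z) c \<Longrightarrow> opb (F Y - F Z) (r * c)"
    and r: "0 \<le> r" "r < 1"
    and closed: "\<And>Y Z. clin_tendsto Y Z \<Longrightarrow> (\<And>n. Pr (Y n)) \<Longrightarrow> Pr Z"
  obtains Z where "Pr Z" "F Z = Z"
proof -
  define Y where "Y n = (F ^^ n) Y0" for n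
  have Pr: "Pr (Y n)" for n
  proof (induction n)
    case 0
    show ?case using start(1) by (simp add: Y_def)
  next
    case (Suc n)
    show ?case using inv[OF Suc] by (simp add: Y_def)
  qed
  have step: "opb (Y (Suc n) - Y n) (c0 * r ^ n)" for n
  proof (induction n)
    case 0
    then show ?case using start(2) by (simp add: Y_def)
  next
    case (Suc n)
    from contr[OF Pr Pr Suc] show ?case by (simp add: Y_def mult.left_commute)
  qed
  obtain Z where Z: "clin_tendsto Y Z"
    by (rule geometric_clin_tendsto[OF step r])
  then obtain e where e: "e \<longlonglongrightarrow> 0" "\<And>n. opb (Z - Y n) (e n)"
    by (auto simp: clin_tendsto_def)
  have PZ: "Pr Z" using closed[OF Z Pr] .
  have "opb (F Z - Y (Suc n)) (r * e n)" for n
    using contr[OF PZ Pr e(2)] by (simp add: Y_def)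
  moreover have "(\<lambda>n. r * e n) \<longlonglongrightarrow> r * 0" by (intro tendsto_intros e)
  ultimately have "clin_tendsto (\<lambda>n. Y (Suc n)) (F Z)"
    unfolding clin_tendsto_def by (intro exI[of _ "\<lambda>n. r * e n"]) simp
  moreover have "clin_tendsto (\<lambda>n. Y (Suc n)) Z"
    unfolding clin_tendsto_def by (intro exI[of _ "\<lambda>n. e (Suc n)"]) (simp add: e LIMSEQ_Suc)
  ultimately have "F Z = Z" by (rule clin_tendsto_unique)
  then show ?thesis using PZ by (rule that[rotated])
qed

end

section \<open>Positive operators\<close>

context prehilbert
begin

section \<open>Scalars, commutation, and roots and inverses close to 1\<close>

abbreviation sc :: "real \<Rightarrow> 'h clin" where "sc r \<equiv> scaleR r 1"

lemma sa_sc [simp]: "sa (sc r)"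
  by (rule has_adj_scaleR) simp

lemma opb_sc: "0 \<le> r \<Longrightarrow> opb (sc r) r"
  using opb_scaleR[OF opb_one, of r] by simp

lemma bicomm_refl [simp]: "bicomm X X" and bicomm_one [simp]: "bicomm X 1"
  and bicomm_zero [simp]: "bicomm X 0"
  by (simp_all add: bicomm_def)

lemma bicommD: "bicomm X Y \<Longrightarrow> has_adj B B' \<Longrightarrow> B * X = X * B \<Longrightarrow> B * Y = Y * B"
  unfolding bicomm_def by blast

lemma bicomm_add:
  assumes "bicomm X Y" "bicomm X Z"
  shows "bicomm X (Y + Z)"
  unfolding bicomm_def
proof (intro allI impI)
  fix B B' assume B: "has_adj B B'" "B * X = X * B"
  show "B * (Y + Z) = (Y + Z) * B"
    by (simp add: distrib_left distrib_right bicommD[OF assms(1) B] bicommD[OF assms(2) B])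
qed

lemma bicomm_diff:
  assumes "bicomm X Y" "bicomm X Z"
  shows "bicomm X (Y - Z)"
  unfolding bicomm_def
proof (intro allI impI)
  fix B B' assume B: "has_adj B B'" "B * X = X * B"
  show "B * (Y - Z) = (Y - Z) * B"
    by (simp add: left_diff_distrib right_diff_distrib bicommD[OF assms(1) B] bicommD[OF assms(2) B])
qed

lemma bicomm_scaleR: "bicomm X Y \<Longrightarrow> bicomm X (scaleR r Y)"
  unfolding bicomm_def by (metis mult_scaleR_left mult_scaleR_right)

lemma bicomm_mult:
  assumes "bicomm X Y" "bicomm X Z"
  shows "bicomm X (Y * Z)"
  unfolding bicomm_def
proof (intro allI impI)
  fix B B' assume B: "has_adj B B'" "B * X = X * B"
  show "B * (Y * Z) = (Y * Z) * B"
    by (simp only: mult.assoc bicommD[OF assms(2) B, symmetric])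
      (simp only: mult.assoc[symmetric] bicommD[OF assms(1) B])
qed

lemma bicomm_trans: "bicomm X Y \<Longrightarrow> bicomm Y Z \<Longrightarrow> bicomm X Z"
  unfolding bicomm_def by blast

lemmas bicomm_intros = bicomm_refl bicomm_one bicomm_zero bicomm_add bicomm_diff bicomm_scaleR
  bicomm_mult

text \<open>The last clause says that \<open>1 - Y\<close> squares to \<open>1 - X\<close>. On the
  ball of radius \<open>r < 1\<close> the map \<open>F\<close> stays in the ball since
  \<open>(r + r * r) / 2\<close> is at most \<open>r\<close>, and it contracts by \<open>r\<close>
  since \<open>Y * Y - Z * Z = Y * (Y - Z) + (Y - Z) * Z\<close>, which needs no
  commutation.\<close>

lemma sqrt_one_minus:
  assumes X: "sa X" "opb X r" "r < 1"
  obtains Y where "sa Y" "opb Y r" "bicomm X Y" "Y + Y = X + Y * Y"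
proof -
  have r: "0 \<le> r" using X(2) by (rule opb_nonneg)
  define F where "F Y = scaleR (1/2) (X + Y * Y)" for Y
  obtain Z where Z: "sa Z \<and> opb Z r \<and> bicomm X Z" "F Z = Z"
  proof (rule contraction_fixpoint[where F = F and ?Y0.0 = 0 and r = r])
    show "sa 0 \<and> opb 0 r \<and> bicomm X 0" using r opb_mono[OF opb_zero] by simp
    show "opb (F 0 - 0) r"
      using opb_mono[OF opb_scaleR[OF X(2), of "1/2"], of r] r by (simp add: F_def)
    show "0 \<le> r" "r < 1" by fact+
  next
    fix Y assume Y: "sa Y \<and> opb Y r \<and> bicomm X Y"
    have "opb (F Y) (\<bar>1/2\<bar> * (r + r * r))"
      unfolding F_def using X(2) Y by (intro opb_scaleR opb_add opb_mult) auto
    moreover have "\<bar>1/2\<bar> * (r + r * r) \<le> r" using r X(3) mult_left_mono[of r 1 r] by simp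
    ultimately have "opb (F Y) r" by (rule opb_mono)
    then show "sa (F Y) \<and> opb (F Y) r \<and> bicomm X (F Y)"
      unfolding F_def using X(1) Y by (intro conjI has_adj_intros bicomm_intros) auto
  next
    fix Y Z c assume Y: "sa Y \<and> opb Y r \<and> bicomm X Y" and Z: "sa Z \<and> opb Z r \<and> bicomm X Z"
      and c: "opb (Y - Z) c"
    have "F Y - F Z = scaleR (1/2) (Y * (Y - Z) + (Y - Z) * Z)"
      by (simp add: F_def algebra_simps)
    moreover have "opb \<dots> (\<bar>1/2\<bar> * (r * c + c * r))"
      using Y Z c by (intro opb_scaleR opb_add opb_mult) auto
    ultimately show "opb (F Y - F Z) (r * c)" by (simp add: mult.commute)
  next
    fix Y Z assume "clin_tendsto Y Z" "\<And>n. sa (Y n) \<and> opb (Y n) r \<and> bicomm X (Y n)"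
    then show "sa Z \<and> opb Z r \<and> bicomm X Z"
      by (meson sa_clin_tendsto opb_clin_tendsto bicomm_clin_tendsto)
  qed
  have "Z + Z = scaleR 2 (F Z)" using Z(2) by (simp add: scaleR_2)
  also have "\<dots> = X + Z * Z" by (simp add: F_def)
  finally show ?thesis using Z that by blast
qed

lemma neumann_inverse:
  assumes X: "sa X" "opb X r" "r < 1"
  obtains Z where "sa Z" "opb Z (1 / (1 - r))" "bicomm X Z" "Z * (1 - X) = 1" "(1 - X) * Z = 1"
proof -
  have r: "0 \<le> r" using X(2) by (rule opb_nonneg)
  define F where "F Z = 1 + X * Z" for Z
  \<comment> \<open>The radius that solves \<open>1 + r * c = c\<close>, so that \<open>F\<close>
    maps the ball of radius \<open>c\<close> into itself.\<close>
  define c where "c = 1 / (1 - r)"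
  have c: "0 \<le> c" "1 + r * c = c" using X(3) by (auto simp: c_def field_simps)
  obtain Z where Z: "sa Z \<and> opb Z c \<and> bicomm X Z" "F Z = Z"
  proof (rule contraction_fixpoint[where F = F and ?Y0.0 = 0 and r = r])
    show "sa 0 \<and> opb 0 c \<and> bicomm X 0" using c opb_mono[OF opb_zero] by simp
    show "opb (F 0 - 0) 1" by (simp add: F_def)
    show "0 \<le> r" "r < 1" by fact+
  next
    fix Y assume Y: "sa Y \<and> opb Y c \<and> bicomm X Y"
    have "opb (F Y) (1 + r * c)"
      unfolding F_def using X(2) Y by (intro opb_add opb_mult opb_one) auto
    then have "opb (F Y) c" by (simp add: c)
    moreover have "sa (F Y)"
      unfolding F_def using X(1) Y bicommD[of X Y X X] by (intro has_adj_add has_adj_one sa_mult) auto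
    ultimately show "sa (F Y) \<and> opb (F Y) c \<and> bicomm X (F Y)"
      unfolding F_def using Y by (intro conjI bicomm_intros) auto
  next
    fix Y Z d assume d: "opb (Y - Z) d"
    have "F Y - F Z = X * (Y - Z)"
      by (simp add: F_def algebra_simps)
    then show "opb (F Y - F Z) (r * d)" using X(2) d by (simp add: opb_mult)
  next
    fix Y Z assume "clin_tendsto Y Z" "\<And>n. sa (Y n) \<and> opb (Y n) c \<and> bicomm X (Y n)"
    then show "sa Z \<and> opb Z c \<and> bicomm X Z"
      by (meson sa_clin_tendsto opb_clin_tendsto bicomm_clin_tendsto)
  qed
  have "(1 - X) * Z = 1" using Z(2) by (simp add: F_def algebra_simps)
  moreover have "Z * (1 - X) = (1 - X) * Z"
    using Z(1) bicommD[of X Z X X] X(1) by (simp add: algebra_simps)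
  ultimately show ?thesis using Z that by (auto simp: c_def)
qed

section \<open>The cone of positive operators\<close>

definition pos :: "'h clin \<Rightarrow> bool" where
  "pos T \<longleftrightarrow> sa T \<and> (\<exists>t. opb (sc t - T) t)"

lemma pos_sa: "pos T \<Longrightarrow> sa T"
  by (simp add: pos_def)

lemma pos_bounded:
  assumes "pos T"
  obtains c where "opb T c"
proof -
  obtain t where t: "opb (sc t - T) t" using assms by (auto simp: pos_def)
  have "opb (sc t - (sc t - T)) (t + t)"
    using t opb_nonneg by (intro opb_diff opb_sc) auto
  then show ?thesis using that by simp
qed

lemma pos_add:
  assumes "pos S" "pos T"
  shows "pos (S + T)"
proof -
  obtain s where s: "opb (sc s - S) s" using assms by (auto simp: pos_def)
  obtain t where t: "opb (sc t - T) t" using assms by (auto simp: pos_def)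
  have "opb (sc (s + t) - (S + T)) (s + t)"
    using opb_add[OF s t] by (simp add: algebra_simps)
  then show ?thesis using assms by (auto simp: pos_def intro: has_adj_add)
qed

lemma pos_scaleR:
  assumes "pos T" "0 \<le> r"
  shows "pos (scaleR r T)"
proof -
  obtain t where t: "opb (sc t - T) t" using assms by (auto simp: pos_def)
  have "opb (sc (r * t) - scaleR r T) (r * t)"
    using opb_scaleR[OF t, of r] assms by (simp add: algebra_simps)
  then show ?thesis using assms by (auto simp: pos_def intro: has_adj_scaleR)
qed

lemma pos_sc: "0 \<le> r \<Longrightarrow> pos (sc r)"
  by (auto simp: pos_def intro!: exI[of _ r] opb_mono[OF opb_zero])

lemma pos_sc_minus: "sa T \<Longrightarrow> opb T t \<Longrightarrow> pos (sc t - T)"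
  by (auto simp: pos_def intro!: exI[of _ t] has_adj_diff)

text \<open>A shift by \<open>d\<close> turns the bound \<open>t\<close> of \<open>sc t - T\<close>
  into the strict contraction factor \<open>t / (t + d)\<close>, which makes the root and the
  inverse above available.\<close>

lemma pos_shift:
  assumes "pos T" "0 < d"
  obtains s X r where "0 < s" "sa X" "opb X r" "r < 1" "bicomm T X" "T + sc d = scaleR s (1 - X)"
proof -
  obtain t where t: "opb (sc t - T) t" using assms by (auto simp: pos_def)
  have t0: "0 \<le> t" using t by (rule opb_nonneg)
  define X where "X = scaleR (1 / (t + d)) (sc t - T)"
  have "opb X (\<bar>1 / (t + d)\<bar> * t)" unfolding X_def by (rule opb_scaleR[OF t])
  moreover have "\<bar>1 / (t + d)\<bar> * t < 1" using t0 assms(2) by simp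
  moreover have "sa X" unfolding X_def using pos_sa[OF assms(1)] by (intro has_adj_intros)
  moreover have "bicomm T X" unfolding X_def by (intro bicomm_intros)
  moreover have "T + sc d = scaleR (t + d) (1 - X)"
  proof -
    have "scaleR (t + d) (1 - X) = sc (t + d) - (sc t - T)"
      using t0 assms(2) by (simp add: X_def scaleR_right_diff_distrib)
    then show ?thesis by (simp add: algebra_simps)
  qed
  ultimately show ?thesis using that[of "t + d" X] t0 assms(2) by simp
qed

lemma pos_shift_sqrt:
  assumes "pos T" "0 < d"
  obtains R where "pos R" "R * R = T + sc d" "bicomm T R"
proof -
  obtain s X r where X: "0 < s" "sa X" "opb X r" "r < 1" "bicomm T X" "T + sc d = scaleR s (1 - X)"
    using pos_shift[OF assms] .
  obtain Y where Y: "sa Y" "opb Y r" "bicomm X Y" "Y + Y = X + Y * Y"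
    using sqrt_one_minus[OF X(2-4)] .
  define R where "R = scaleR (sqrt s) (1 - Y)"
  have "R * R = scaleR s (1 - (Y + Y) + Y * Y)"
    using X(1) by (simp add: R_def algebra_simps)
  also have "\<dots> = T + sc d" by (simp add: Y(4) X(6))
  finally have RR: "R * R = T + sc d" .
  have "opb (sc (sqrt s) - R) (sqrt s * r)"
    using opb_scaleR[OF Y(2), of "sqrt s"] X(1) by (simp add: R_def algebra_simps)
  then have "opb (sc (sqrt s) - R) (sqrt s)"
    by (rule opb_mono) (use X(1,4) in simp)
  moreover have "sa R" unfolding R_def using Y(1) by (intro has_adj_intros)
  ultimately have "pos R" by (auto simp: pos_def)
  moreover have "bicomm T R"
    unfolding R_def using bicomm_trans[OF X(5) Y(3)] by (intro bicomm_intros)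
  ultimately show ?thesis using RR that by blast
qed

text \<open>Here \<open>K + \<i>L\<close> is a multiple of a unitary.\<close>

lemma opb_sum_squares:
  assumes "sa K" "sa L" "K * L = L * K" "K * K + L * L = sc c" "0 \<le> c"
  shows "opb K (sqrt c)"
proof -
  define U where "U = K + scaleC \<i> L"
  define V where "V = K + scaleC (- \<i>) L"
  have UV: "has_adj U V"
    unfolding U_def V_def using has_adj_add[OF assms(1) has_adj_scaleC[OF assms(2), of \<i>]] by simp
  have "V * U = K * K + L * L + (scaleC \<i> (K * L) + scaleC (- \<i>) (K * L))"
    by (simp add: U_def V_def distrib_left distrib_right mult_scaleC_clin_left
        mult_scaleC_clin_right scaleC_scaleC scaleC_one scaleC_add_right assms(3))
  also have "scaleC \<i> (K * L) + scaleC (- \<i>) (K * L) = 0"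
    by (simp flip: scaleC_add_left)
  finally have "opb (V * U) c" using assms(4,5) by (simp add: opb_sc)
  with UV have U: "opb U (sqrt c)" by (rule opb_cstar)
  with UV have V: "opb V (sqrt c)" by (rule opb_adj)
  have "scaleC \<i> L + scaleC (- \<i>) L = 0" by (simp flip: scaleC_add_left)
  then have "U + V = K + K" by (simp add: U_def V_def algebra_simps)
  then have "K = scaleR (1/2) (U + V)" by (simp flip: scaleR_2)
  then show ?thesis
    using opb_scaleR[OF opb_add[OF U V], of "1/2"] by simp
qed

lemma opb_sc_minus_square:
  assumes K: "sa K" "opb K c" "c < d"
  shows "opb (sc (d * d) - K * K) (d * d)"
proof -
  have c: "0 \<le> c" using K(2) by (rule opb_nonneg)
  define X where "X = scaleR (1 / (d * d)) (K * K)"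
  have "opb X (\<bar>1 / (d * d)\<bar> * (c * c))"
    unfolding X_def by (intro opb_scaleR opb_mult K)
  moreover have "\<bar>1 / (d * d)\<bar> * (c * c) < 1"
    using c K(3) by (simp add: divide_less_eq mult_strict_mono')
  moreover have "sa X" unfolding X_def using K(1) by (intro has_adj_intros)
  ultimately obtain Y where Y: "sa Y" "bicomm X Y" "Y + Y = X + Y * Y"
    using sqrt_one_minus[of X] by metis
  \<comment> \<open>\<open>L\<close> is the root of \<open>sc (d * d) - K * K\<close> and commutes
    with \<open>K\<close>. The two squares add up to a scalar, so \<open>opb_sum_squares\<close>
    bounds \<open>L\<close> by \<open>d\<close>.\<close>
  define L where "L = scaleR d (1 - Y)"
  have "L * L = scaleR (d * d) (1 - (Y + Y) + Y * Y)"
    by (simp add: L_def algebra_simps)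
  also have "\<dots> = sc (d * d) - K * K"
    using c K(3) by (simp add: Y(3) X_def scaleR_right_diff_distrib)
  finally have LL: "L * L = sc (d * d) - K * K" .
  have "K * X = X * K" by (simp add: X_def mult.assoc)
  then have "K * Y = Y * K" using bicommD[OF Y(2) K(1)] by simp
  then have "L * K = K * L" by (simp add: L_def algebra_simps)
  moreover have "sa L" unfolding L_def using Y(1) by (intro has_adj_intros)
  ultimately have "opb L (sqrt (d * d))"
    using K(1) by (intro opb_sum_squares[of L K]) (auto simp: LL)
  then have "opb (L * L) (sqrt (d * d) * sqrt (d * d))" by (intro opb_mult)
  then show ?thesis by (simp add: LL)
qed

lemma pos_square: "sa K \<Longrightarrow> opb K c \<Longrightarrow> pos (K * K)"
  unfolding pos_def using opb_sc_minus_square[of K c "c + 1"] has_adj_mult[of K K K K] by auto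

text \<open>Every bound \<open>t\<close> of \<open>T\<close> can serve as the witness in
  \<open>pos\<close>, not just some large one; this makes the cone closed. Write
  \<open>T + sc d\<close> as a square, apply the preceding estimate for squares, and let
  \<open>d\<close> tend to 0.\<close>

lemma opb_sc_minus_pos:
  assumes "pos T" "opb T t"
  shows "opb (sc t - T) t"
proof (rule opb_limit)
  fix e :: real assume "e > 0"
  define d where "d = e / 3"
  have d: "0 < d" "e = d + d + d" using \<open>e > 0\<close> by (auto simp: d_def)
  have t: "0 \<le> t" using assms(2) by (rule opb_nonneg)
  obtain R where R: "pos R" "R * R = T + sc d"
    using pos_shift_sqrt[OF assms(1) d(1)] by blast
  have "opb (R * R) (t + d)"
    unfolding R(2) using assms(2) d(1) by (intro opb_add opb_sc) auto
  then have "opb R (sqrt (t + d))" using pos_sa[OF R(1)] opb_cstar by blast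
  then have "opb (sc (sqrt (t + d + d) * sqrt (t + d + d)) - R * R) (sqrt (t + d + d) * sqrt (t + d + d))"
    using pos_sa[OF R(1)] d(1) by (intro opb_sc_minus_square) auto
  then have "opb (sc (t + d + d) - (T + sc d)) (t + d + d)"
    using t d(1) by (simp add: R(2))
  moreover have "sc (t + d + d) - (T + sc d) = sc (t + d) - T"
    by (simp only: scaleR_left_distrib) (simp add: algebra_simps)
  ultimately have "opb (sc (t + d) - T) (t + d + d)" by (simp only:)
  from opb_diff[OF this opb_sc[of d]] show "opb (sc t - T) (t + e)"
    using d by (simp add: algebra_simps)
qed

lemma pos_limit:
  assumes "sa T" "\<And>e. e > 0 \<Longrightarrow> \<exists>S. pos S \<and> opb (T - S) e"
  shows "pos T"
proof -
  obtain S where S: "pos S" "opb (T - S) 1" using assms(2)[of 1] by auto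
  obtain c where "opb S c" using pos_bounded[OF S(1)] .
  from opb_add[OF S(2) this] obtain t where t: "opb T t" by auto
  have "opb (sc t - T) t"
  proof (rule opb_limit)
    fix e :: real assume "e > 0"
    define d where "d = e / 3"
    have d: "0 < d" "e = d + d + d" using \<open>e > 0\<close> by (auto simp: d_def)
    obtain S where S: "pos S" "opb (T - S) d" using assms(2)[OF d(1)] by auto
    have "opb S (t + d)" using opb_diff[OF t S(2)] by simp
    then have "opb (sc (t + d) - S) (t + d)" using S(1) by (intro opb_sc_minus_pos)
    then have "opb ((sc (t + d) - S) - (T - S) - sc d) (t + d + d + d)"
      using d(1) by (intro opb_diff[OF opb_diff[OF _ S(2)] opb_sc]) auto
    then show "opb (sc t - T) (t + e)" using d by (simp add: algebra_simps)
  qed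
  then show ?thesis using assms(1) by (auto simp: pos_def)
qed

text \<open>Monotonicity of the norm on the cone. The roots of \<open>T + sc d\<close> and
  \<open>sc t - T + sc d\<close> commute and their squares add up to \<open>sc (t + d + d)\<close>,
  so \<open>opb_sum_squares\<close> bounds the first root.\<close>

lemma opb_pos_mono:
  assumes "pos T" "pos (S - T)" "opb S t"
  shows "opb T t"
proof (rule opb_limit)
  fix e :: real assume "e > 0"
  define d where "d = e / 3"
  have d: "0 < d" "e = d + d + d" using \<open>e > 0\<close> by (auto simp: d_def)
  have t: "0 \<le> t" using assms(3) by (rule opb_nonneg)
  have "sa S" using has_adj_add[OF pos_sa[OF assms(2)] pos_sa[OF assms(1)]] by simp
  then have "pos (sc t - S)" using assms(3) by (rule pos_sc_minus)
  from pos_add[OF this assms(2)] have tT: "pos (sc t - T)" by simp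
  obtain K where K: "pos K" "K * K = T + sc d" "bicomm T K"
    using pos_shift_sqrt[OF assms(1) d(1)] .
  obtain L where L: "pos L" "L * L = sc t - T + sc d" "bicomm (sc t - T) L"
    using pos_shift_sqrt[OF tT d(1)] .
  have "T * K = K * T" using bicommD[OF K(3) pos_sa[OF assms(1)]] by simp
  then have "K * (sc t - T) = (sc t - T) * K" by (simp add: algebra_simps)
  then have "K * L = L * K" using bicommD[OF L(3) pos_sa[OF K(1)]] by simp
  moreover have "K * K + L * L = sc (t + d + d)"
    by (simp only: K(2) L(2) scaleR_left_distrib) (simp add: algebra_simps)
  ultimately have "opb K (sqrt (t + d + d))"
    using t d(1) by (intro opb_sum_squares[of K L] pos_sa K L) auto
  then have "opb (K * K) (sqrt (t + d + d) * sqrt (t + d + d))" by (intro opb_mult)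
  then have "opb (K * K) (t + d + d)" using t d(1) by simp
  from opb_diff[OF this opb_sc[of d]] show "opb T (t + e)"
    using d by (simp add: K(2) algebra_simps)
qed

text \<open>The product is a limit of squares \<open>(K * L) * (K * L)\<close> with commuting roots
  of the shifted factors. Shifted roots are used because the construction of exact roots rests on
  this lemma.\<close>

lemma pos_mult:
  assumes "pos A" "pos B" "A * B = B * A"
  shows "pos (A * B)"
proof (rule pos_limit)
  show "sa (A * B)" using assms by (intro sa_mult pos_sa)
  fix e :: real assume e: "e > 0"
  obtain a where a: "opb A a" using pos_bounded[OF assms(1)] .
  obtain b where b: "opb B b" using pos_bounded[OF assms(2)] .
  have ab: "0 \<le> a" "0 \<le> b" using a b opb_nonneg by auto
  \<comment> \<open>The error of the approximation is at most \<open>d * (a + b + d)\<close>; with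
    \<open>d\<close> at most 1 this choice keeps it below \<open>e\<close>.\<close>
  define d where "d = min 1 (e / (a + b + 1))"
  have d: "0 < d" "d \<le> 1" "d * (a + b + 1) \<le> e"
    using e ab by (auto simp: d_def min_mult_distrib_right)
  obtain K where K: "pos K" "K * K = A + sc d" "bicomm A K"
    using pos_shift_sqrt[OF assms(1) d(1)] .
  obtain L where L: "pos L" "L * L = B + sc d" "bicomm B L"
    using pos_shift_sqrt[OF assms(2) d(1)] .
  have "B * K = K * B" using bicommD[OF K(3) pos_sa[OF assms(2)]] assms(3) by simp
  then have KL: "K * L = L * K" using bicommD[OF L(3) pos_sa[OF K(1)]] by simp
  obtain k where k: "opb K k" using pos_bounded[OF K(1)] .
  obtain l where l: "opb L l" using pos_bounded[OF L(1)] .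
  have "pos ((K * L) * (K * L))"
    using pos_sa K(1) L(1) KL by (intro pos_square[OF _ opb_mult[OF k l]] sa_mult) auto
  moreover have "(K * L) * (K * L) = (K * K) * (L * L)"
    by (metis KL mult.assoc)
  moreover have "A * B - (K * K) * (L * L) = - (scaleR d (A + B + sc d))"
    by (simp add: K(2) L(2) algebra_simps)
  moreover have "opb (- (scaleR d (A + B + sc d))) (\<bar>d\<bar> * (a + b + d))"
    using a b d by (intro opb_minus opb_scaleR opb_add opb_sc) auto
  moreover have "\<bar>d\<bar> * (a + b + d) \<le> e"
    using order_trans[OF mult_left_mono[of "a + b + d" "a + b + 1" d] d(3)] d(1,2) by simp
  ultimately show "\<exists>S. pos S \<and> opb (A * B - S) e"
    by (metis opb_mono)
qed

section \<open>Inverses, square roots and absolute values\<close>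

lemma pos_shift_inverse:
  assumes "pos T" "0 < d"
  obtains Z where "pos Z" "bicomm T Z" "Z * (T + sc d) = 1" "(T + sc d) * Z = 1"
proof -
  obtain s X r where X: "0 < s" "sa X" "opb X r" "r < 1" "bicomm T X" "T + sc d = scaleR s (1 - X)"
    using pos_shift[OF assms] .
  obtain Z0 where Z0: "sa Z0" "opb Z0 (1 / (1 - r))" "bicomm X Z0" "Z0 * (1 - X) = 1" "(1 - X) * Z0 = 1"
    using neumann_inverse[OF X(2-4)] .
  define Z where "Z = scaleR (1 / s) Z0"
  have inv: "Z * (T + sc d) = 1" "(T + sc d) * Z = 1"
    using X(1) Z0(4,5) by (simp_all add: Z_def X(6))
  have saZ: "sa Z" unfolding Z_def using Z0(1) by (rule has_adj_scaleR)
  have TZ: "bicomm T Z" unfolding Z_def using bicomm_trans[OF X(5) Z0(3)] by (rule bicomm_scaleR)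
  \<comment> \<open>The root makes \<open>Z\<close> a square, \<open>Z = (Z * R) * (Z * R)\<close>,
    and hence positive.\<close>
  obtain R where R: "pos R" "R * R = T + sc d" "bicomm T R"
    using pos_shift_sqrt[OF assms] .
  have "T * R = R * T" using bicommD[OF R(3) pos_sa[OF assms(1)]] by simp
  then have RZ: "R * Z = Z * R" using bicommD[OF TZ pos_sa[OF R(1)]] by simp
  obtain c where "opb R c" using pos_bounded[OF R(1)] .
  from opb_mult[OF opb_scaleR[OF Z0(2), of "1 / s"] this]
  have "pos ((Z * R) * (Z * R))"
    unfolding Z_def[symmetric] using saZ pos_sa[OF R(1)] RZ by (intro pos_square[of "Z * R"] sa_mult) auto
  also have "(Z * R) * (Z * R) = Z * (R * R) * Z"
    by (metis RZ mult.assoc)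
  also have "\<dots> = Z" by (simp add: R(2) inv)
  finally show ?thesis using TZ inv that by blast
qed

text \<open>Hoelder continuity of the square root for commuting roots. The case of a positive
  \<open>e\<close> gives convergence of approximate roots, the case \<open>e = 0\<close> uniqueness
  of roots.\<close>

lemma pos_sqrt_step:
  assumes R: "pos R" "pos S" "R * S = S * R" "R * R - S * S = sc e" "0 \<le> e"
  shows "opb (R - S) (sqrt e)"
proof -
  define D where "D = R - S"
  obtain r where r: "opb R r" using pos_bounded[OF R(1)] .
  obtain s where s: "opb S s" using pos_bounded[OF R(2)] .
  have saD: "sa D" unfolding D_def using R(1,2) by (intro has_adj_diff pos_sa)
  have D: "opb D (r + s)" unfolding D_def by (rule opb_diff[OF r s])
  have DRS: "D * (R + S) = sc e" "(R + S) * D = sc e"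
    using R(3,4) by (simp_all add: D_def algebra_simps)
  have sum: "(R + S) * (R + S) = D * D + scaleR 4 (R * S)"
    using R(3) scaleR_add_left[of 2 2 "R * S"] by (simp add: D_def algebra_simps scaleR_2)
  have lc: "R * (S * X) = S * (R * X)" for X by (metis R(3) mult.assoc)
  have DRS': "R * (S * D) = D * (R * S)"
    by (simp add: D_def right_diff_distrib left_diff_distrib mult.assoc R(3) lc)
  \<comment> \<open>Since \<open>(R + S) * (R + S)\<close> equals \<open>D * D + 4 * R * S\<close>,
    the scalar \<open>e * e\<close> is the fourth power of \<open>D\<close> plus the positive
    element \<open>4 * D * D * R * S\<close>; monotonicity of the norm then bounds the fourth
    power.\<close>
  have "sc (e * e) = D * ((R + S) * (R + S)) * D"
  proof -
    have "D * ((R + S) * (R + S)) * D = (D * (R + S)) * ((R + S) * D)" by (simp only: mult.assoc)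
    then show ?thesis by (simp add: DRS)
  qed
  also have "\<dots> = (D * D) * (D * D) + scaleR 4 ((D * D) * (R * S))"
    unfolding sum by (simp add: distrib_left distrib_right mult.assoc DRS')
  finally have eq: "sc (e * e) - (D * D) * (D * D) = scaleR 4 ((D * D) * (R * S))" by simp
  have DD: "pos (D * D)" using saD D by (rule pos_square)
  have "pos ((D * D) * (R * S))"
    by (rule pos_mult[OF DD pos_mult[OF R(1-3)]]) (metis DRS' mult.assoc)
  then have "pos (sc (e * e) - (D * D) * (D * D))" unfolding eq by (rule pos_scaleR) simp
  moreover have "pos ((D * D) * (D * D))" using DD DD refl by (rule pos_mult)
  moreover have "opb (sc (e * e)) (e * e)" by (rule opb_sc) simp
  ultimately have "opb ((D * D) * (D * D)) (e * e)" using opb_pos_mono by blast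
  then have "opb (D * D) (sqrt (e * e))" using pos_sa[OF DD] by (intro opb_cstar[of "D * D" "D * D"])
  then have "opb D (sqrt e)" using saD R(5) opb_cstar[of D D e] by simp
  then show ?thesis by (simp add: D_def)
qed

lemma pos_sqrt:
  assumes "pos T"
  obtains R where "pos R" "R * R = T" "bicomm T R"
proof -
  \<comment> \<open>Shifts by powers of 1/4 make consecutive roots differ by at most the
    corresponding powers of 1/2, a summable sequence.\<close>
  have "\<exists>R. pos R \<and> R * R = T + sc ((1/4) ^ n) \<and> bicomm T R" for n :: nat
    using pos_shift_sqrt[OF assms, of "(1/4) ^ n"] by (metis zero_less_power zero_less_divide_1_iff zero_less_numeral)
  then obtain R where R: "\<And>n. pos (R n)" "\<And>n. R n * R n = T + sc ((1/4) ^ n)" "\<And>n. bicomm T (R n)"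
    by metis
  have TR: "T * R n = R n * T" for n using bicommD[OF R(3) pos_sa[OF assms]] by simp
  have comm: "R m * R n = R n * R m" for m n
    using bicommD[OF R(3) pos_sa[OF R(1)]] TR by simp
  have "opb (R (Suc n) - R n) (1 * (1/2) ^ n)" for n
  proof -
    have "opb (R n - R (Suc n)) (sqrt ((1/4) ^ n - (1/4) ^ Suc n))"
    proof (intro pos_sqrt_step R comm)
      show "R n * R n - R (Suc n) * R (Suc n) = sc ((1/4) ^ n - (1/4) ^ Suc n)"
        by (simp only: R(2) scaleR_left_diff_distrib add_diff_cancel_left)
    qed simp
    moreover have "sqrt ((1/4) ^ n - (1/4) ^ Suc n) \<le> sqrt (((1/2) ^ n)\<^sup>2)"
      by (rule real_sqrt_le_mono) (simp add: power2_eq_square flip: power_mult_distrib)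
    ultimately show ?thesis
      by (auto intro!: opb_minus_commute[of "R n"] elim: opb_mono)
  qed
  then obtain S where S: "clin_tendsto R S"
    by (rule geometric_clin_tendsto) auto
  then obtain e where e: "e \<longlonglongrightarrow> 0" "\<And>n. opb (S - R n) (e n)"
    by (auto simp: clin_tendsto_def)
  have "sa S" using S by (rule sa_clin_tendsto) (rule pos_sa[OF R(1)])
  have "pos S"
  proof (rule pos_limit[OF \<open>sa S\<close>])
    fix d :: real assume "d > 0"
    then obtain n where "e n < d"
      using order_tendstoD(2)[OF e(1), of d] by (auto simp: eventually_sequentially)
    then show "\<exists>S'. pos S' \<and> opb (S - S') d"
      using R(1)[of n] e(2)[of n] opb_mono[of "S - R n" "e n" d] by auto
  qed
  obtain c where c: "opb S c" using pos_bounded[OF \<open>pos S\<close>] .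
  have "clin_tendsto (\<lambda>n. R n * R n) (S * S)"
  proof -
    have "opb (S * S - R n * R n) (c * e n + e n * (c + e n))" for n
    proof -
      have "opb (S * (S - R n) + (S - R n) * (S - (S - R n))) (c * e n + e n * (c + e n))"
        by (intro opb_add opb_mult opb_diff c e)
      then show ?thesis by (simp add: algebra_simps)
    qed
    moreover have "(\<lambda>n. c * e n + e n * (c + e n)) \<longlonglongrightarrow> c * 0 + 0 * (c + 0)"
      by (intro tendsto_intros e)
    ultimately show ?thesis
      unfolding clin_tendsto_def by (intro exI[of _ "\<lambda>n. c * e n + e n * (c + e n)"]) simp
  qed
  moreover have "clin_tendsto (\<lambda>n. R n * R n) T"
    unfolding clin_tendsto_def
  proof (intro exI[of _ "\<lambda>n. (1/4) ^ n"] conjI allI)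
    show "(\<lambda>n. (1/4) ^ n :: real) \<longlonglongrightarrow> 0" by (rule LIMSEQ_realpow_zero) auto
    show "opb (T - R n * R n) ((1/4) ^ n)" for n
      using opb_minus[OF opb_sc[of "(1/4) ^ n"]] by (simp add: R(2))
  qed
  ultimately have "S * S = T" by (rule clin_tendsto_unique)
  moreover have "bicomm T S" using S R(3) by (rule bicomm_clin_tendsto)
  ultimately show ?thesis using \<open>pos S\<close> that by blast
qed

text \<open>Here \<open>p\<close> is the absolute value of \<open>h\<close>. The claim is shown for
  the invertible \<open>q = p + sc d\<close> in place of \<open>p\<close>, as \<open>d\<close> tends
  to 0.\<close>

lemma pos_abs_minus:
  assumes h: "sa h" "opb h c" and p: "pos p" "p * p = h * h" "p * h = h * p"
  shows "pos (p - h)"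
proof (rule pos_limit)
  show "sa (p - h)" using h(1) pos_sa[OF p(1)] by (rule has_adj_diff[rotated])
  fix d :: real assume d: "d > 0"
  define q where "q = p + sc d"
  obtain Z where Z: "pos Z" "bicomm p Z" "Z * q = 1" "q * Z = 1"
    unfolding q_def using pos_shift_inverse[OF p(1) d] .
  \<comment> \<open>A sum of positive elements that equals \<open>2 * q * (q - h)\<close>, by
    \<open>p * p = h * h\<close>; multiplying by the positive inverse \<open>Z\<close> of
    \<open>q\<close> leaves \<open>q - h\<close> positive.\<close>
  define N where "N = (q - h) * (q - h) + (scaleR (2 * d) p + sc (d * d))"
  obtain b where b: "opb p b" using pos_bounded[OF p(1)] .
  have "opb (q - h) (b + d + c)"
    unfolding q_def using d by (intro opb_diff opb_add b opb_sc h) auto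
  then have N: "pos N"
    unfolding N_def using d p(1) h(1) pos_sa[OF p(1)]
    by (intro pos_add pos_scaleR pos_sc pos_square) (auto simp: q_def intro!: has_adj_intros)
  have qh: "q * (q - h) = scaleR (1/2) N"
  proof -
    have "N = q * (q - h) + q * (q - h)"
      using p(2,3) by (simp add: N_def q_def algebra_simps flip: scaleR_2)
    then show ?thesis by (simp flip: scaleR_2)
  qed
  have "p * Z = Z * p" using bicommD[OF Z(2) pos_sa[OF p(1)]] by simp
  moreover have "h * Z = Z * h" using bicommD[OF Z(2) h(1)] p(3) by simp
  ultimately have "Z * (q - h) = (q - h) * Z" by (simp add: q_def algebra_simps)
  then have "Z * N = N * Z"
    using \<open>p * Z = Z * p\<close> by (simp add: N_def distrib_left distrib_right) (metis mult.assoc)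
  then have "pos (scaleR (1/2) (Z * N))" using Z(1) N by (intro pos_scaleR pos_mult) auto
  also have "scaleR (1/2) (Z * N) = Z * (q * (q - h))" by (simp add: qh)
  also have "\<dots> = q - h" by (simp add: Z(3) flip: mult.assoc)
  finally have "pos (q - h)" .
  moreover have "opb ((p - h) - (q - h)) d"
    using opb_minus[OF opb_sc[of d]] d by (simp add: q_def)
  ultimately show "\<exists>S. pos S \<and> opb (p - h - S) d" by blast
qed

text \<open>With \<open>c = - Y\<^sup>* Y\<close> and \<open>E = Y Y\<^sup>*\<close>, both positive, the elements \<open>c (\<rho> + c)\<^sup>2\<close> and \<open>E (\<rho> - E)\<^sup>2\<close> have
  equal norm; the first dominates \<open>2 \<rho> c\<^sup>2\<close>, the second has norm at most \<open>\<rho>\<^sup>3\<close> as soon as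
  \<open>\<rho>\<close> bounds \<open>c\<close>. Hence every bound of \<open>c\<close> can be improved by the factor \<open>1 / \<surd>2\<close>. This replaces the
  comparison of the spectra of \<open>Y Y\<^sup>*\<close> and \<open>Y\<^sup>* Y\<close>.\<close>

lemma skew_positive_imp_zero:
  assumes Y: "has_adj Y Y'" "opb Y y" and E: "pos (Y * Y')" and c: "pos (- (Y' * Y))"
  shows "Y = 0"
proof -
  define E where "E = Y * Y'"
  define c where "c = - (Y' * Y)"
  have posc: "pos c" and posE: "pos E" using assms by (simp_all add: c_def E_def)
  have improve: "opb c (\<rho> * sqrt (1/2))" if \<rho>: "opb c \<rho>" for \<rho>
  proof (cases "\<rho> = 0")
    case False
    have \<rho>0: "0 < \<rho>" using opb_nonneg[OF \<rho>] False by simp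
    have "opb (Y' * Y) \<rho>" using opb_minus[OF \<rho>] by (simp add: c_def)
    then have "opb Y (sqrt \<rho>)" using Y(1) opb_cstar by blast
    then have "opb E (sqrt \<rho> * sqrt \<rho>)"
      unfolding E_def using opb_adj[OF Y(1)] by (intro opb_mult) auto
    then have opbE: "opb E \<rho>" using \<rho>0 by simp
    define W where "W = (sc \<rho> - E) * Y"
    define W' where "W' = Y' * (sc \<rho> - E)"
    have W: "has_adj W W'" unfolding W_def W'_def using pos_sa[OF posE] Y(1) by (intro has_adj_intros)
    have "opb ((sc \<rho> - E) * E * (sc \<rho> - E)) (\<rho> * \<rho> * \<rho>)"
      by (intro opb_mult opbE opb_sc_minus_pos posE)
    then have "opb (W * W') (\<rho> * \<rho> * \<rho>)"
      by (simp add: W_def W'_def E_def mult.assoc)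
    then have "opb W' (sqrt (\<rho> * \<rho> * \<rho>))" using has_adj_sym[OF W] opb_cstar by blast
    then have "opb (W' * W) (sqrt (\<rho> * \<rho> * \<rho>) * sqrt (\<rho> * \<rho> * \<rho>))"
      using opb_adj[OF has_adj_sym[OF W]] by (intro opb_mult) auto
    then have WW: "opb (- (W' * W)) (\<rho> * \<rho> * \<rho>)" using \<rho>0 by (intro opb_minus) simp
    have "W = Y * (sc \<rho> + c)" by (simp add: W_def c_def E_def algebra_simps)
    moreover have "W' = (sc \<rho> + c) * Y'" by (simp add: W'_def c_def E_def algebra_simps)
    ultimately have "- (W' * W) = (sc \<rho> + c) * c * (sc \<rho> + c)" by (simp add: c_def mult.assoc)
    also have "\<dots> = scaleR (2 * \<rho>) (c * c) + (scaleR (\<rho> * \<rho>) c + c * (c * c))"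
      by (simp add: algebra_simps flip: scaleR_2)
    finally have "- (W' * W) - scaleR (2 * \<rho>) (c * c) = scaleR (\<rho> * \<rho>) c + c * (c * c)" by simp
    moreover have cc: "pos (c * c)" using posc by (intro pos_mult) auto
    then have "pos (c * (c * c))" using posc by (intro pos_mult) (auto simp: mult.assoc)
    then have "pos (scaleR (\<rho> * \<rho>) c + c * (c * c))"
      using \<rho>0 posc by (intro pos_add pos_scaleR) auto
    ultimately have "opb (scaleR (2 * \<rho>) (c * c)) (\<rho> * \<rho> * \<rho>)"
      using \<rho>0 by (intro opb_pos_mono[OF pos_scaleR[OF cc] _ WW]) auto
    from opb_scaleR[OF this, of "1 / (2 * \<rho>)"] have "opb (c * c) (\<rho> * \<rho> * (1/2))"
      using \<rho>0 by simp
    then have "opb c (sqrt (\<rho> * \<rho> * (1/2)))" using pos_sa[OF posc] opb_cstar by blast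
    then show ?thesis using \<rho>0 by (simp add: real_sqrt_mult real_sqrt_divide)
  qed (use \<rho> in simp)
  obtain \<rho> where \<rho>: "opb c \<rho>" using pos_bounded[OF posc] .
  have bd: "opb c (\<rho> * sqrt (1/2) ^ n)" for n
  proof (induction n)
    case (Suc n)
    from improve[OF this] show ?case by (simp only: power_Suc2 mult.assoc)
  qed (use \<rho> in simp)
  have "opb c 0"
  proof (rule opb_limit)
    fix d :: real assume "d > 0"
    have "(\<lambda>n. \<rho> * sqrt (1/2) ^ n) \<longlonglongrightarrow> \<rho> * 0"
      by (intro tendsto_intros LIMSEQ_realpow_zero) (auto simp: real_sqrt_divide)
    then have "(\<lambda>n. \<rho> * sqrt (1/2) ^ n) \<longlonglongrightarrow> 0" by simp
    from order_tendstoD(2)[OF this \<open>d > 0\<close>] obtain n where "\<rho> * sqrt (1/2) ^ n < d"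
      unfolding eventually_sequentially by blast
    then show "opb c (0 + d)" using bd[of n] by (auto elim: opb_mono)
  qed
  then have "c = 0" by (rule opb_zero_imp_zero)
  then have "Y' * Y = 0" by (simp add: c_def)
  then have "opb Y 0" using opb_cstar[OF Y(1), of 0] by simp
  then show ?thesis by (rule opb_zero_imp_zero)
qed

text \<open>With \<open>m = p - h\<close>, where \<open>p\<close> is the absolute value of
  \<open>h = T' * T\<close>, the operator \<open>Y = T * m\<close> has \<open>Y' * Y\<close> equal
  to minus half the cube of \<open>m\<close>. The preceding lemma forces \<open>Y = 0\<close>, so
  \<open>m = 0\<close> and \<open>h = p\<close> is positive.\<close>

lemma pos_adj_mult:
  assumes T: "has_adj T T'" "opb T t"
  shows "pos (T' * T)"
proof -
  define h where "h = T' * T"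
  have h: "sa h" unfolding h_def using has_adj_mult[OF has_adj_sym[OF T(1)] T(1)] .
  have T': "opb T' t" using T by (rule opb_adj)
  have ht: "opb h (t * t)" unfolding h_def using T' T(2) by (rule opb_mult)
  obtain p where p: "pos p" "p * p = h * h" "bicomm (h * h) p"
    using pos_sqrt[OF pos_square[OF h ht]] .
  have ph: "p * h = h * p" using bicommD[OF p(3) h] by (simp add: mult.assoc)
  define m where "m = p - h"
  define n where "n = p + h"
  have m: "pos m" unfolding m_def using h ht p(1,2) ph by (rule pos_abs_minus)
  have mn: "m * n = 0" using p(2) ph by (simp add: m_def n_def algebra_simps)
  have h2: "h + h = n - m" by (simp add: m_def n_def)
  obtain b where b: "opb m b" using pos_bounded[OF m] .
  define Y where "Y = T * m"
  define Y' where "Y' = m * T'"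
  have Y: "has_adj Y Y'" unfolding Y_def Y'_def using T(1) pos_sa[OF m] by (rule has_adj_mult)
  have Yb: "opb Y (t * b)" unfolding Y_def using T(2) b by (rule opb_mult)
  have Y'b: "opb Y' (t * b)" using Y Yb by (rule opb_adj)
  have "Y' * Y + Y' * Y = m * (h + h) * m"
    by (simp add: Y_def Y'_def h_def algebra_simps)
  also have "\<dots> = - (m * (m * m))" unfolding h2 by (simp add: right_diff_distrib left_diff_distrib mn mult.assoc)
  finally have YY2: "Y' * Y + Y' * Y = - (m * (m * m))" .
  have "- (Y' * Y) = scaleR (1/2) (- (Y' * Y + Y' * Y))" by (simp flip: scaleR_2)
  then have YY: "- (Y' * Y) = scaleR (1/2) (m * (m * m))" by (simp only: YY2 minus_minus)
  have mmm: "pos (m * (m * m))" using m by (intro pos_mult) (auto simp: mult.assoc)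
  then have c: "pos (- (Y' * Y))" unfolding YY by (rule pos_scaleR) simp
  \<comment> \<open>\<open>A\<close> and \<open>B\<close> are twice the real part and minus twice
    the imaginary part of \<open>Y\<close>. Their squares add up to
    \<open>2 * (Y * Y' + Y' * Y)\<close>, which makes \<open>Y * Y'\<close> a sum of positive
    elements.\<close>
  define A where "A = Y + Y'"
  define B where "B = scaleC \<i> (Y - Y')"
  have "sa A" unfolding A_def using has_adj_add[OF Y has_adj_sym[OF Y]] by (simp add: add.commute)
  have "sa B"
  proof -
    have "scaleC (cnj \<i>) (Y' - Y) = B"
      by (simp add: B_def scaleC_diff_right scaleC_minus_left)
    then show ?thesis
      using has_adj_scaleC[OF has_adj_diff[OF Y has_adj_sym[OF Y]], of \<i>] by (simp add: B_def)
  qed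
  have Ab: "opb A (t * b + t * b)" unfolding A_def using Yb Y'b by (rule opb_add)
  have Bb: "opb B (cmod \<i> * (t * b + t * b))"
    unfolding B_def using Yb Y'b by (intro opb_scaleC opb_diff)
  have "scaleC (-1) X = - X" for X :: "'h clin"
    by (simp add: scaleC_minus_left scaleC_one)
  then have BB: "B * B = - ((Y - Y') * (Y - Y'))"
    by (simp add: B_def mult_scaleC_clin_left mult_scaleC_clin_right scaleC_scaleC)
  have "A * A + B * B = scaleR 2 (Y * Y' + Y' * Y)"
    unfolding BB A_def scaleR_2 by (simp add: algebra_simps)
  then have "Y * Y' = scaleR (1/2) (A * A + B * B) + - (Y' * Y)"
    by simp
  moreover have "pos \<dots>"
    using c pos_square[OF \<open>sa A\<close> Ab] pos_square[OF \<open>sa B\<close> Bb] by (intro pos_add pos_scaleR) auto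
  ultimately have "pos (Y * Y')" by simp
  from skew_positive_imp_zero[OF Y Yb this c] have "Y = 0" .
  then have "m * (m * m) = 0" using YY2 by simp
  then have "(m * m) * (m * m) = 0" by (simp add: mult.assoc)
  then have "m * m = 0" by (rule sa_square_zero[OF sa_mult[OF pos_sa[OF m] pos_sa[OF m] refl]])
  then have "m = 0" using pos_sa[OF m] by (rule sa_square_zero[rotated])
  then show ?thesis using p(1) by (simp add: m_def h_def)
qed

lemma pos_conj:
  assumes "pos S" "has_adj T T'" "opb T t"
  shows "pos (T' * S * T)"
proof -
  obtain R where R: "pos R" "R * R = S" using pos_sqrt[OF assms(1)] by blast
  obtain r where r: "opb R r" using pos_bounded[OF R(1)] .
  have "pos ((T' * R) * (R * T))"
    by (rule pos_adj_mult[OF has_adj_mult[OF pos_sa[OF R(1)] assms(2)] opb_mult[OF r assms(3)]])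
  also have "(T' * R) * (R * T) = T' * S * T" by (simp add: mult.assoc flip: R(2))
  finally show ?thesis .
qed

end

section \<open>Boundedness of adjointable maps and the Cauchy-Schwarz inequality\<close>

context prehilbert
begin

interpretation metric: Metric_space UNIV "\<lambda>x y. nrm (x - y)"
proof
  show "nrm (x - y) = 0 \<longleftrightarrow> x = y" for x y using nrm_eq_zero[of "x - y"] by auto
qed (rule nrm_nonneg nrm_minus_commute nrm_triangle_diff)+

lemma mcomplete_metric: "metric.mcomplete"
  unfolding metric.mcomplete_def
proof (intro allI impI)
  fix X assume X: "metric.MCauchy X"
  have "\<forall>e>0. \<exists>N. \<forall>m\<ge>N. \<forall>n\<ge>N. nrm (X m - X n) < e"
  proof (intro allI impI)
    fix e :: real assume "e > 0"
    then obtain N where "\<forall>m n. N \<le> m \<longrightarrow> N \<le> n \<longrightarrow> nrm (X m - X n) < e"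
      using X by (auto simp: metric.MCauchy_def)
    then show "\<exists>N. \<forall>m\<ge>N. \<forall>n\<ge>N. nrm (X m - X n) < e" by (intro exI[of _ N]) simp
  qed
  from complete[OF this] obtain L where "(\<lambda>n. nrm (X n - L)) \<longlonglongrightarrow> 0" ..
  then show "\<exists>L. limitin metric.mtopology X L sequentially"
    by (auto simp: metric.limitin_metric_dist_null)
qed

text \<open>Continuity of \<open>T\<close> is not yet known, so the adjoint supplies lower
  semicontinuity: \<open>inn (ap T y) (ap T y) - inn (ap T y) (ap T z)\<close> equals
  \<open>inn (ap S (ap T y)) (y - z)\<close>, which is small for \<open>z\<close> near
  \<open>y\<close>.\<close>

lemma closedin_adjointable_sublevel:
  assumes T: "has_adj T S"
  shows "closedin metric.mtopology {y. nrm (ap T y) \<le> k}"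
  unfolding metric.closedin_metric
proof (intro conjI allI impI subset_UNIV)
  fix y assume "y \<in> UNIV - {y. nrm (ap T y) \<le> k}"
  then have yk: "k < nrm (ap T y)" by simp
  show "\<exists>r>0. disjnt {y. nrm (ap T y) \<le> k} (metric.mball y r)"
  proof (cases "k < 0")
    case True
    then have "{y. nrm (ap T y) \<le> k} = {}" by (auto simp: not_le intro: less_le_trans)
    then show ?thesis by (intro exI[of _ 1]) simp
  next
    case False
    then have y0: "0 < nrm (ap T y)" using yk by simp
    define s where "s = nrm (ap S (ap T y)) + 1"
    have s: "0 < s" by (simp add: s_def add_nonneg_pos)
    \<comment> \<open>Chosen so that \<open>s * r\<close> is
      \<open>nrm (ap T y) * (nrm (ap T y) - k)\<close>, exactly the loss that keeps
      \<open>nrm (ap T z)\<close> above \<open>k\<close>.\<close>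
    define r where "r = nrm (ap T y) * (nrm (ap T y) - k) / s"
    have r: "0 < r" using y0 yk s by (simp add: r_def)
    have "k < nrm (ap T z)" if "nrm (y - z) < r" for z
    proof -
      have "inn (ap T y) (ap T y) = inn (ap T y) (ap T z) + inn (ap S (ap T y)) (y - z)"
        using has_adj_sym[OF T] by (simp add: has_adj_def inn_diff_right)
      then have "(nrm (ap T y))\<^sup>2 \<le> norm (inn (ap T y) (ap T z)) + norm (inn (ap S (ap T y)) (y - z))"
        by (simp add: nrm_square norm_triangle_ineq)
      also have "\<dots> \<le> nrm (ap T y) * nrm (ap T z) + nrm (ap S (ap T y)) * nrm (y - z)"
        by (intro add_mono cauchy_schwarz)
      also have "nrm (ap S (ap T y)) * nrm (y - z) \<le> s * nrm (y - z)"
        by (intro mult_right_mono) (auto simp: s_def)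
      also have "s * nrm (y - z) < s * r" using that s by (intro mult_strict_left_mono)
      also have "s * r = nrm (ap T y) * (nrm (ap T y) - k)" using s by (simp add: r_def)
      finally have "nrm (ap T y) * k < nrm (ap T y) * nrm (ap T z)"
        by (simp add: power2_eq_square right_diff_distrib)
      then show ?thesis using y0 by simp
    qed
    then show ?thesis using r by (intro exI[of _ r]) (fastforce simp: disjnt_iff)
  qed
qed

text \<open>The Hellinger-Toeplitz theorem by Baire category: the closed sets \<open>E k\<close>
  exhaust the complete space, so one of them contains a ball. Translating that ball to 0 and scaling
  gives the bound.\<close>

lemma has_adj_bounded:
  assumes T: "has_adj T S"
  obtains c where "opb T c"
proof -
  define E where "E k = {y. nrm (ap T y) \<le> real k}" for k
  have "\<exists>k. metric.mtopology interior_of (E k) \<noteq> {}"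
  proof (rule ccontr)
    assume "\<not> ?thesis"
    then have "metric.mtopology interior_of \<Union>(range E) = {}"
      using closedin_adjointable_sublevel[OF T]
      by (intro metric.metric_Baire_category_alt mcomplete_metric) (auto simp: E_def)
    moreover have "\<Union>(range E) = UNIV" by (auto simp: E_def intro: real_arch_simple)
    ultimately show False
      using interior_of_topspace[of metric.mtopology] by simp
  qed
  then obtain k y where y: "y \<in> metric.mtopology interior_of (E k)" by blast
  have "openin metric.mtopology (metric.mtopology interior_of (E k))" by (rule openin_interior_of)
  then obtain r where r0: "0 < r" "metric.mball y r \<subseteq> metric.mtopology interior_of (E k)"
    using y unfolding metric.openin_mtopology by auto
  have r: "0 < r" "metric.mball y r \<subseteq> E k"
    using r0 interior_of_subset[of metric.mtopology "E k"] by auto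
  have ball: "nrm (ap T z) \<le> 2 * real k" if "nrm z < r" for z
  proof -
    have "y + z \<in> metric.mball y r" using that by (simp add: nrm_minus)
    then have "y + z \<in> E k" using r(2) by (rule rev_subsetD)
    then have "nrm (ap T (y + z)) \<le> k" by (simp add: E_def)
    moreover have "y \<in> metric.mball y r" using r(1) by simp
    then have "y \<in> E k" using r(2) by (rule rev_subsetD)
    then have "nrm (ap T y) \<le> k" by (simp add: E_def)
    moreover have "nrm (ap T z) \<le> nrm (ap T (y + z)) + nrm (ap T y)"
      using nrm_triangle[of "ap T (y + z)" "- ap T y"] by (simp add: ap_add nrm_minus)
    ultimately show ?thesis by simp
  qed
  have "nrm (ap T x) \<le> 4 * real k / r * nrm x" for x
  proof (cases "x = 0")
    case False
    then have x: "0 < nrm x" using nrm_eq_zero[of x] nrm_nonneg[of x] by linarith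
    define a where "a = r / (2 * nrm x)"
    have a: "0 < a" "a * nrm x < r" using x r(1) by (auto simp: a_def)
    then have "a * nrm (ap T x) \<le> 2 * real k"
      using ball[of "scaleR a x"] by (simp add: nrm_scaleR ap_scaleR_right)
    then show ?thesis using x r(1) by (simp add: a_def field_simps)
  qed simp
  then have "opb T (4 * real k / r)" using r(1) by (simp add: opb_def)
  then show ?thesis using that by blast
qed

end

section \<open>A C*-algebra as a module over itself\<close>

lemma hnorm_star_mult: "hnorm (\<lambda>x y::'a::cstar_algebra. star x * y) x = norm x"
  by (simp add: hnorm_def cstar_identity)

interpretation self: prehilbert "\<lambda>x y::'a::cstar_algebra. star x * y"
proof (standard, goal_cases)
  case (4 x)
  then show ?case using cstar_identity[of x] by simp
next
  case (5 X)
  then have "Cauchy X" by (simp add: hnorm_star_mult Cauchy_def dist_norm)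
  then obtain L where "X \<longlonglongrightarrow> L" using Cauchy_convergent convergent_def by blast
  then show ?case
    by (auto simp: hnorm_star_mult intro!: exI[of _ L] tendsto_norm_zero LIM_zero)
next
  case (6 x y)
  then show ?case using norm_mult_ineq[of "star x" y] by (simp add: hnorm_star_mult norm_star)
qed (simp_all add: distrib_left mult_scaleC_right star_mult star_star)

text \<open>The algebra may lack a unit; left multiplication embeds it in a ring of operators that
  contains the scalars \<open>self.sc t\<close>.\<close>

lift_definition lmul :: "'a::cstar_algebra \<Rightarrow> 'a clin" is "\<lambda>a x. a * x"
  by (simp add: distrib_left mult_scaleC_right)

lemma lmul_mult: "lmul (a * b) = lmul a * lmul b"
  and lmul_diff: "lmul (a - b) = lmul a - lmul b"
  and lmul_scaleR: "lmul (scaleR r a) = scaleR r (lmul a)"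
  by (auto intro!: clin_eqI simp: lmul.rep_eq clin_ap ap_scaleR mult.assoc algebra_simps)

lemma has_adj_lmul: "self.has_adj (lmul a) (lmul (star a))"
  by (simp add: self.has_adj_def lmul.rep_eq star_mult mult.assoc)

lemma opb_lmul_iff: "self.opb (lmul a) c \<longleftrightarrow> norm a \<le> c"
proof
  assume "self.opb (lmul a) c"
  \<comment> \<open>The vector \<open>star a\<close> is where left multiplication by
    \<open>a\<close> attains its norm.\<close>
  then have c: "0 \<le> c" "norm (a * star a) \<le> c * norm (star a)"
    by (auto simp: self.opb_def lmul.rep_eq hnorm_star_mult)
  moreover have "norm (a * star a) = norm a * norm a"
    using cstar_identity[of "star a"] by (simp add: star_star norm_star power2_eq_square)
  ultimately show "norm a \<le> c"
    by (cases "a = 0") (auto simp: norm_star)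
next
  assume "norm a \<le> c"
  moreover have "norm (a * x) \<le> c * norm x" for x
    using \<open>norm a \<le> c\<close> by (meson mult_right_mono norm_ge_zero norm_mult_ineq order_trans)
  ultimately show "self.opb (lmul a) c"
    using order_trans[OF norm_ge_zero \<open>norm a \<le> c\<close>] by (auto simp: self.opb_def lmul.rep_eq hnorm_star_mult)
qed

lemma pos_lmul: "cstar_positive a \<Longrightarrow> self.pos (lmul a)"
  unfolding cstar_positive_def
  by (auto simp: lmul_mult opb_lmul_iff intro!: self.pos_adj_mult[OF has_adj_lmul])

section \<open>The Cauchy-Schwarz inequality of a Hilbert module\<close>

context hilbert_cstar_module
begin

sublocale sesquilinear inn
  by standard (simp_all add: inn_add_right inn_scaleC_right inn_star inn_definite)

lemma inn_act_left: "inn (act x a) y = star a * inn x y"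
  by (metis inn_act_right inn_star star_mult)

lemma inn_cauchy_schwarz: "norm (inn x y) \<le> hnorm inn x * hnorm inn y"
proof (cases "x = 0")
  case False
  define c where "c = inn x x"
  define t where "t = norm c"
  define a where "a = inn x y"
  have t: "0 < t" using False inn_definite by (auto simp: t_def c_def)
  \<comment> \<open>The module form of the usual test vector, scaled by \<open>t\<close> because
    \<open>c\<close> need not be invertible.\<close>
  define z where "z = scaleR t y - act x a"
  have yx: "inn y x = star a" by (simp add: a_def inn_star)
  have zz: "inn z z = scaleR (t * t) (inn y y) - scaleR t (star a * a)
      - (scaleR t (star a * a) - star a * c * a)"
    by (simp add: z_def scaleR_scaleC inn_diff_left inn_diff_right inn_scaleC_left inn_scaleC_right
        inn_act_left inn_act_right yx c_def[symmetric] a_def[symmetric] mult_scaleC_left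
        mult_scaleC_right scaleC_diff_right scaleC_scaleC left_diff_distrib mult.assoc)
  \<comment> \<open>Both summands on the right are positive: \<open>inn z z\<close> by assumption,
    and the other because \<open>c\<close> is bounded by its norm \<open>t\<close>. Hence
    \<open>t * star a * a\<close> lies below \<open>t * t * inn y y\<close>, and taking norms gives
    the inequality.\<close>
  have eq: "lmul (scaleR (t * t) (inn y y)) - lmul (scaleR t (star a * a))
      = lmul (inn z z) + lmul (star a) * (self.sc t - lmul c) * lmul a"
    by (simp only: zz lmul_diff lmul_mult lmul_scaleR) (simp add: algebra_simps)
  have "self.has_adj (lmul c) (lmul c)" using has_adj_lmul[of c] by (simp add: c_def inn_star)
  moreover have "self.opb (lmul c) t" by (simp add: opb_lmul_iff t_def)
  ultimately have "self.pos (self.sc t - lmul c)" by (rule self.pos_sc_minus)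
  then have "self.pos (lmul (star a) * (self.sc t - lmul c) * lmul a)"
    using has_adj_lmul by (rule self.pos_conj[where t = "norm a"]) (simp add: opb_lmul_iff)
  then have diff: "self.pos (lmul (scaleR (t * t) (inn y y)) - lmul (scaleR t (star a * a)))"
    unfolding eq using pos_lmul[OF inn_pos] by (rule self.pos_add[rotated])
  have "cstar_positive (star a * a)" by (auto simp: cstar_positive_def)
  then have "self.pos (lmul (scaleR t (star a * a)))"
    unfolding lmul_scaleR using t by (intro self.pos_scaleR pos_lmul) auto
  then have "self.opb (lmul (scaleR t (star a * a))) (norm (scaleR (t * t) (inn y y)))"
    using diff by (rule self.opb_pos_mono) (simp add: opb_lmul_iff)
  then have "t * (norm a)\<^sup>2 \<le> t * (t * norm (inn y y))"
    using t by (simp add: opb_lmul_iff cstar_identity mult.assoc)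
  then have "(norm a)\<^sup>2 \<le> t * norm (inn y y)" using t by simp
  then have "sqrt ((norm a)\<^sup>2) \<le> sqrt (t * norm (inn y y))" by (rule real_sqrt_le_mono)
  then show ?thesis by (simp add: a_def t_def c_def hnorm_def real_sqrt_mult)
qed (simp add: hnorm_def)

sublocale prehilbert inn
  by standard (fact complete, fact inn_cauchy_schwarz)

end

section \<open>Operators of the statement\<close>

lemma ap_comp: "ap S \<circ> ap T = ap (S * T)"
  by (auto simp: clin_ap)

lemma scaleC_two: "scaleC 2 x = x + (x::'a::cplx_vector)"
  using scaleC_add_left[of 1 1 x] by (simp add: scaleC_one)

context prehilbert
begin

section \<open>Functions on the module as linear maps, and uniqueness of the defined
  operators\<close>

lemma adjointable_ap: "has_adj T S \<Longrightarrow> adjointable inn (ap T)"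
  by (auto simp: has_adj_def adjointable_def)

lemma linear_of_adjoint:
  assumes "\<And>x y. inn (f x) y = inn x (g y)"
  shows "ap (Clin f) = f"
proof (rule Clin_inverse, safe)
  show "f (x + y) = f x + f y" for x y by (rule inn_eqI) (simp add: assms inn_add_left)
  show "f (scaleC c x) = scaleC c (f x)" for c x by (rule inn_eqI) (simp add: assms inn_scaleC_left)
qed

lemma adjointableE:
  assumes "adjointable inn f"
  obtains T S where "f = ap T" "has_adj T S"
proof -
  obtain g where fg: "\<And>x y. inn (f x) y = inn x (g y)"
    using assms by (auto simp: adjointable_def)
  then have gf: "\<And>x y. inn (g x) y = inn x (f y)" by (metis inn_star)
  have "has_adj (Clin f) (Clin g)"
    using fg linear_of_adjoint[OF fg] linear_of_adjoint[OF gf] by (simp add: has_adj_def)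
  then show ?thesis using that[of "Clin f"] linear_of_adjoint[OF fg] by simp
qed

lemma adj_ap:
  assumes "has_adj T S"
  shows "adj inn (ap T) = ap S"
  unfolding adj_def
proof (rule some_equality)
  show "\<forall>x y. inn (ap T x) y = inn x (ap S y)" using assms by (simp add: has_adj_def)
  fix g assume g: "\<forall>x y. inn (ap T x) y = inn x (g y)"
  show "g = ap S"
  proof
    fix y
    show "g y = ap S y" by (rule inn_eqI) (metis assms g has_adj_def inn_star)
  qed
qed

lemma sa_ap_iff:
  assumes "has_adj T S"
  shows "adj inn (ap T) = ap T \<longleftrightarrow> sa T"
  using assms adj_ap[OF assms] adj_ap[of T T] by (auto simp: ap_inject)

text \<open>Identifies positivity as a product of an adjoint with its operator with the metric
  notion \<open>pos\<close>: one direction is \<open>pos_adj_mult\<close> with automatic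
  boundedness, the other the existence of roots.\<close>

lemma pos_op_iff: "pos_op inn f \<longleftrightarrow> (\<exists>T. f = ap T \<and> pos T)"
proof
  assume "pos_op inn f"
  then obtain g where g: "adjointable inn g" "f = adj inn g \<circ> g" by (auto simp: pos_op_def)
  obtain S S' where S: "g = ap S" "has_adj S S'" using adjointableE[OF g(1)] .
  obtain c where "opb S c" using has_adj_bounded[OF S(2)] .
  with S(2) have "pos (S' * S)" by (rule pos_adj_mult)
  moreover have "f = ap (S' * S)" by (simp add: g(2) S(1) adj_ap[OF S(2)] ap_comp)
  ultimately show "\<exists>T. f = ap T \<and> pos T" by blast
next
  assume "\<exists>T. f = ap T \<and> pos T"
  then obtain T where T: "f = ap T" "pos T" by blast
  obtain R where R: "pos R" "R * R = T" using pos_sqrt[OF T(2)] by blast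
  have "f = adj inn (ap R) \<circ> ap R" using adj_ap[OF pos_sa[OF R(1)]] by (simp add: ap_comp R(2) T(1))
  then show "pos_op inn f"
    unfolding pos_op_def using adjointable_ap[OF pos_sa[OF R(1)]] adjointable_ap[OF pos_sa[OF T(2)]]
    by (auto simp: T(1))
qed

text \<open>\<open>R\<close> and \<open>S\<close> need not be known to commute: each commutes with
  its own square, hence with the root \<open>U\<close> that bicommutes with that square, and is
  compared with \<open>U\<close>.\<close>

lemma pos_sqrt_unique:
  assumes "pos R" "pos S" "R * R = S * S"
  shows "R = S"
proof -
  obtain r where "opb R r" using pos_bounded[OF assms(1)] .
  then have "pos (R * R)" using pos_sa[OF assms(1)] by (intro pos_square)
  then obtain U where U: "pos U" "U * U = R * R" "bicomm (R * R) U" using pos_sqrt by blast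
  have eq: "V = U" if V: "pos V" "V * V = R * R" for V
  proof -
    have "V * U = U * V" using bicommD[OF U(3) pos_sa[OF V(1)]] by (simp add: mult.assoc flip: V(2))
    then have "opb (V - U) (sqrt 0)" using V U by (intro pos_sqrt_step) auto
    then show ?thesis using opb_zero_imp_zero[of "V - U"] by simp
  qed
  show ?thesis using eq[of R] eq[of S] assms by simp
qed

lemma op_sqrt_ap:
  assumes "pos R" "T = R * R"
  shows "op_sqrt inn (ap T) = ap R"
  unfolding op_sqrt_def
proof (rule the_equality)
  show "pos_op inn (ap R) \<and> ap R \<circ> ap R = ap T"
    using assms by (auto simp: pos_op_iff ap_comp)
  fix f assume "pos_op inn f \<and> f \<circ> f = ap T"
  then obtain S where S: "f = ap S" "pos S" "ap (S * S) = ap T" by (auto simp: pos_op_iff ap_comp)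
  then show "f = ap R" using pos_sqrt_unique[of S R] assms by (simp add: ap_inject)
qed

lemma is_mp_inverse_ap:
  assumes "has_adj T T'" "has_adj X X'"
  shows "is_mp_inverse inn (ap T) (ap X) \<longleftrightarrow>
    T * X * T = T \<and> X * T * X = X \<and> sa (T * X) \<and> sa (X * T)"
  using adjointable_ap[OF assms(2)] sa_ap_iff[OF has_adj_mult[OF assms(1,2)]]
    sa_ap_iff[OF has_adj_mult[OF assms(2,1)]]
  by (simp add: is_mp_inverse_def ap_comp ap_inject)

text \<open>Penrose's uniqueness argument: taking adjoints in
  \<open>T * X = (T * Y) * (T * X)\<close> gives \<open>T * X = T * Y\<close>, similarly
  \<open>X * T = Y * T\<close>, and these determine the inverse.\<close>

lemma mp_inv_ap:
  assumes T: "has_adj T T'" and X: "has_adj X X'" and TX: "is_mp_inverse inn (ap T) (ap X)"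
  shows "mp_inv inn (ap T) = ap X"
  unfolding mp_inv_def
proof (rule the_equality)
  show "is_mp_inverse inn (ap T) (ap X)" by (rule TX)
  fix f assume f: "is_mp_inverse inn (ap T) f"
  then have "adjointable inn f" by (simp add: is_mp_inverse_def)
  then obtain Y Y' where Y: "f = ap Y" "has_adj Y Y'" by (rule adjointableE)
  have x: "T * X * T = T" "X * T * X = X" "sa (T * X)" "sa (X * T)"
    using TX by (simp_all add: is_mp_inverse_ap[OF T X])
  have y: "T * Y * T = T" "Y * T * Y = Y" "sa (T * Y)" "sa (Y * T)"
    using f by (simp_all add: is_mp_inverse_ap[OF T Y(2)] Y(1))
  have "T * X = (T * Y) * (T * X)" using y(1) by (simp flip: mult.assoc)
  moreover have "has_adj ((T * Y) * (T * X)) ((T * X) * (T * Y))" using y(3) x(3) by (rule has_adj_mult)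
  ultimately have "T * X = (T * X) * (T * Y)" using x(3) has_adj_unique by metis
  then have TXY: "T * X = T * Y" using x(1) by (simp flip: mult.assoc)
  have "X * T = (X * T) * (Y * T)" using y(1) by (simp add: mult.assoc)
  moreover have "has_adj ((X * T) * (Y * T)) ((Y * T) * (X * T))" using x(4) y(4) by (rule has_adj_mult)
  ultimately have "X * T = (Y * T) * (X * T)" using x(4) has_adj_unique by metis
  then have XYT: "X * T = Y * T" using x(1) by (simp add: mult.assoc)
  have "Y = (Y * T) * Y" using y(2) by simp
  also have "\<dots> = X * (T * X)" by (simp add: mult.assoc TXY flip: XYT)
  also have "\<dots> = X" using x(2) by (simp add: mult.assoc)
  finally show "f = ap X" by (simp add: Y(1))
qed

lemma op_inverse_ap:
  assumes "has_adj X X'" "X * A = 1" "A * X = 1"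
  shows "op_inverse inn (ap A) = ap X"
  unfolding op_inverse_def
proof (rule the_equality)
  have one: "ap 1 = id" by (auto simp: clin_ap)
  then show "adjointable inn (ap X) \<and> ap X \<circ> ap A = id \<and> ap A \<circ> ap X = id"
    using adjointable_ap[OF assms(1)] by (simp add: ap_comp assms)
  fix f assume f: "adjointable inn f \<and> f \<circ> ap A = id \<and> ap A \<circ> f = id"
  have "f = f \<circ> (ap A \<circ> ap X)" by (simp add: ap_comp assms(3) one)
  also have "\<dots> = ap X" using f by (simp flip: comp_assoc)
  finally show "f = ap X" .
qed

lemma range_proj_ap:
  assumes P: "sa P" "P * P = P" "P * Q = Q" "Q * P = P"
  shows "range_proj inn (ap Q) = ap P"
  unfolding range_proj_def
proof (rule the_equality)
  have eq: "ap P (ap Q x) = ap Q x" "ap Q (ap P x) = ap P x" for x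
    using P(3,4) by (metis clin_ap(6))+
  have "range (ap P) = range (ap Q)"
  proof (intro equalityI subsetI)
    show "x \<in> range (ap Q)" if "x \<in> range (ap P)" for x using that eq(2) by (metis rangeE rangeI)
    show "x \<in> range (ap P)" if "x \<in> range (ap Q)" for x using that eq(1) by (metis rangeE rangeI)
  qed
  then show "adjointable inn (ap P) \<and> ap P \<circ> ap P = ap P \<and> adj inn (ap P) = ap P \<and> range (ap P) = range (ap Q)"
    using adjointable_ap[OF P(1)] adj_ap[OF P(1)] by (simp add: ap_comp P(2))
  fix f assume f: "adjointable inn f \<and> f \<circ> f = f \<and> adj inn f = f \<and> range f = range (ap Q)"
  then obtain G G' where G: "f = ap G" "has_adj G G'" using adjointableE by blast
  have saG: "sa G" using f sa_ap_iff[OF G(2)] by (simp add: G(1))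
  have GG: "ap G (ap G x) = ap G x" for x using f by (metis G(1) comp_apply)
  have rng: "range (ap G) = range (ap P)" using f \<open>range (ap P) = range (ap Q)\<close> by (simp add: G(1))
  have "G * P = P"
  proof (rule clin_eqI)
    fix x
    obtain y where "ap P x = ap G y" using rng by (metis rangeE rangeI)
    then show "ap (G * P) x = ap P x" by (simp add: clin_ap GG)
  qed
  moreover have "P * G = G"
  proof (rule clin_eqI)
    fix x
    obtain y where "ap G x = ap P y" using rng by (metis rangeE rangeI)
    moreover have "ap P (ap P y) = ap P y" using P(2) by (metis clin_ap(6))
    ultimately show "ap (P * G) x = ap G x" by (simp add: clin_ap)
  qed
  \<comment> \<open>The adjoint of \<open>P * G = G\<close> reads \<open>G * P = G\<close>, while
    \<open>G * P = P\<close>.\<close>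
  ultimately have "G = P" using has_adj_mult[OF P(1) saG] saG has_adj_unique by metis
  then show "f = ap P" by (simp add: G(1))
qed

lemma matched_proj_ap:
  assumes R: "has_adj R R'" and A: "pos A" "A * A = R * R'"
    and X: "has_adj X X'" "is_mp_inverse inn (ap A) (ap X)"
    and Z: "has_adj Z Z'" "Z * (A + 1) = 1" "(A + 1) * Z = 1"
  shows "matched_proj inn (ap R) = ap (scaleR (1/2) ((A + R') * X * Z * (A + R)))"
proof -
  have "op_abs inn (adj inn (ap R)) = ap A"
    unfolding op_abs_def adj_ap[OF R] adj_ap[OF has_adj_sym[OF R]] ap_comp
    using A by (intro op_sqrt_ap) auto
  moreover have "mp_inv inn (ap A) = ap X" using pos_sa[OF A(1)] X by (rule mp_inv_ap)
  moreover have "(\<lambda>x. ap A x + x) = ap (A + 1)" by (auto simp: clin_ap)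
  then have "op_inverse inn (\<lambda>x. ap A x + x) = ap Z" using op_inverse_ap[OF Z] by simp
  ultimately show ?thesis
    unfolding matched_proj_def adj_ap[OF R] Let_def
    by (auto simp: clin_ap ap_scaleR scaleR_scaleC)
qed

text \<open>Kaplansky's formula: \<open>N + 1\<close> is invertible, commutes with \<open>Q\<close>
  and \<open>Q'\<close>, and satisfies \<open>Q * (N + 1) = Q * Q' * Q\<close>, so
  \<open>Q * Q'\<close> times the inverse of \<open>N + 1\<close> is the projection onto the range
  of \<open>Q\<close>.\<close>

lemma range_projection_exists:
  assumes Q: "has_adj Q Q'" "Q * Q = Q"
  obtains P where "sa P" "P * P = P" "P * Q = Q" "Q * P = P"
proof -
  have Q': "Q' * Q' = Q'"
    using has_adj_unique[of Q] Q has_adj_mult[OF Q(1) Q(1)] by metis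
  define N where "N = (Q' - Q) * (Q - Q')"
  have D: "has_adj (Q - Q') (Q' - Q)" using Q(1) has_adj_sym[OF Q(1)] by (rule has_adj_diff)
  obtain c where "opb (Q - Q') c" using has_adj_bounded[OF D] .
  with D have N: "pos N" unfolding N_def by (rule pos_adj_mult)
  have N_eq: "N + 1 = 1 + Q' * Q - Q' - Q + Q * Q'"
    by (simp add: N_def Q(2) Q' algebra_simps)
  have QQ: "Q * (Q * X) = Q * X" "Q' * (Q' * X) = Q' * X" for X
    by (simp_all add: Q(2) Q' flip: mult.assoc)
  have QG: "Q * (N + 1) = Q * Q' * Q"
    unfolding N_eq by (simp add: Q(2) QQ algebra_simps)
  have GQ: "(N + 1) * Q = Q * Q' * Q"
    unfolding N_eq by (simp add: Q(2) QQ algebra_simps)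
  have Q'G: "Q' * (N + 1) = Q' * Q * Q'" "(N + 1) * Q' = Q' * Q * Q'"
    unfolding N_eq by (simp_all add: Q' QQ algebra_simps)
  have one: "N + sc 1 = N + 1" by simp
  obtain Z where Z: "pos Z" "bicomm N Z" "(N + 1) * Z = 1"
    using pos_shift_inverse[OF N, of 1] unfolding one by (metis zero_less_one)
  have "Q * (N + 1) = (N + 1) * Q" by (simp only: QG GQ)
  then have "Q * N = N * Q" by (simp add: distrib_left distrib_right)
  then have QZ: "Q * Z = Z * Q" by (rule bicommD[OF Z(2) Q(1)])
  have "Q' * (N + 1) = (N + 1) * Q'" by (simp only: Q'G)
  then have "Q' * N = N * Q'" by (simp add: distrib_left distrib_right)
  then have Q'Z: "Q' * Z = Z * Q'" by (rule bicommD[OF Z(2) has_adj_sym[OF Q(1)]])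
  define P where "P = Q * Q' * Z"
  have QQ': "sa (Q * Q')" using has_adj_mult[OF Q(1) has_adj_sym[OF Q(1)]] .
  have "(Q * Q') * Z = Z * (Q * Q')" by (metis QZ Q'Z mult.assoc)
  then have "sa P" unfolding P_def by (rule sa_mult[OF QQ' pos_sa[OF Z(1)]])
  moreover have PQ: "P * Q = Q"
  proof -
    have "P * Q = Q * Q' * Q * Z" by (simp add: P_def mult.assoc QZ)
    also have "\<dots> = Q * ((N + 1) * Z)" unfolding QG[symmetric] by (rule mult.assoc)
    finally show ?thesis by (simp add: Z(3))
  qed
  moreover have "Q * P = P" by (simp add: P_def QQ mult.assoc)
  moreover have "P * P = P"
  proof -
    have "P * P = (P * Q) * Q' * Z" by (subst (2) P_def) (simp add: mult.assoc)
    then show ?thesis by (simp only: PQ P_def[symmetric])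
  qed
  ultimately show ?thesis using that by blast
qed

section \<open>The polar form of the supplementary projection\<close>

lemma pos_shift_sqrt_inverse:
  assumes "pos S"
  obtains K L where "pos K" "sa L" "K * K = S + 1" "K * L = 1" "L * K = 1" "bicomm S K" "bicomm S L"
proof -
  have one: "sc 1 = 1" by simp
  obtain K where K: "pos K" "K * K = S + 1" "bicomm S K"
    using pos_shift_sqrt[OF assms, of 1] unfolding one by (metis zero_less_one)
  obtain Z where Z: "pos Z" "bicomm S Z" "Z * (S + 1) = 1" "(S + 1) * Z = 1"
    using pos_shift_inverse[OF assms, of 1] unfolding one by (metis zero_less_one)
  have "S * K = K * S" using bicommD[OF K(3) pos_sa[OF assms]] by simp
  then have KZ: "K * Z = Z * K" using bicommD[OF Z(2) pos_sa[OF K(1)]] by simp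
  have "sa (K * Z)" using pos_sa[OF K(1)] pos_sa[OF Z(1)] KZ by (rule sa_mult)
  moreover have "K * (K * Z) = 1" by (simp add: K(2) Z(4) flip: mult.assoc)
  moreover have "K * Z * K = 1" by (simp add: KZ K(2) Z(3) mult.assoc)
  moreover have "bicomm S (K * Z)" using K(3) Z(2) by (rule bicomm_mult)
  ultimately show ?thesis using K that by blast
qed

text \<open>The last two clauses make \<open>V\<close> a partial isometry with initial projection
  \<open>P\<close>, from which its Moore-Penrose inverse is read off.\<close>

lemma supp_proj_polar:
  assumes Q: "has_adj Q Q'" "Q * Q = Q"
  obtains P V V' where "range_proj inn (ap Q) = ap P" "supp_proj inn (ap Q) = ap (V * V')"
    "has_adj V V'" "V' * V = P" "V * P = V"
proof -
  obtain P where P: "sa P" "P * P = P" "P * Q = Q" "Q * P = P"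
    using range_projection_exists[OF Q] .
  have rP: "range_proj inn (ap Q) = ap P" using P by (rule range_proj_ap)
  have Q'P: "Q' * P = Q'" using has_adj_mult[OF P(1) Q(1)] Q(1) P(3) has_adj_unique by metis
  have PQ': "P * Q' = P" using has_adj_mult[OF Q(1) P(1)] P(1,4) has_adj_unique by metis
  have PP: "P * (P * X) = P * X" "P * (Q * X) = Q * X" "Q * (P * X) = P * X" "Q' * (P * X) = Q' * X"
    "P * (Q' * X) = P * X" for X
    by (simp_all add: P Q'P PQ' flip: mult.assoc)
  define R where "R = P + P - Q"
  define R' where "R' = P + P - Q'"
  have R: "has_adj R R'" unfolding R_def R'_def using P(1) Q(1) by (intro has_adj_intros)
  have RR: "R * R' = Q * Q'" by (simp add: R_def R'_def algebra_simps P PQ' )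
  have RP: "R * P = P" by (simp add: R_def algebra_simps P)
  have PR': "P * R' = P" by (simp add: R'_def algebra_simps P PQ')
  \<comment> \<open>\<open>R * R' = Q * Q'\<close> equals \<open>P + J = (J + 1) * P\<close> with
    \<open>J\<close> positive. So with \<open>B\<close> the invertible root of \<open>J + 1\<close>,
    the absolute value of \<open>R'\<close> is \<open>B * P\<close> and its Moore-Penrose inverse is
    \<open>Bi * P\<close>.\<close>
  define J where "J = (Q - P) * (Q' - P)"
  have J_eq: "J = Q * Q' - P" by (simp add: J_def algebra_simps P PQ' Q'P)
  have D: "has_adj (Q' - P) (Q - P)" using has_adj_sym[OF Q(1)] P(1) by (rule has_adj_diff)
  obtain d where "opb (Q' - P) d" using has_adj_bounded[OF D] .
  with D have J: "pos J" unfolding J_def by (rule pos_adj_mult)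
  have PJ: "P * J = J" "J * P = J" by (simp_all add: J_eq algebra_simps P PP Q'P)
  obtain B Bi where B: "pos B" "sa Bi" "B * B = J + 1" "B * Bi = 1" "Bi * B = 1" "bicomm J B" "bicomm J Bi"
    using pos_shift_sqrt_inverse[OF J] .
  have PB: "P * B = B * P" "P * Bi = Bi * P"
    using bicommD[OF B(6) P(1)] bicommD[OF B(7) P(1)] PJ by simp_all
  have PPB: "P * (B * X) = B * (P * X)" "P * (Bi * X) = Bi * (P * X)" for X
    by (simp_all add: PB flip: mult.assoc)
  have BB: "B * (Bi * X) = X" "Bi * (B * X) = X" for X
    by (simp_all add: B flip: mult.assoc)
  define A where "A = B * P"
  have "pos P" using pos_adj_mult[OF P(1)] has_adj_bounded[OF P(1)] P(2) by metis
  then have A: "pos A" unfolding A_def using B(1) PB by (intro pos_mult) auto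
  have AA: "A * A = R * R'"
  proof -
    have "A * A = B * B * P" by (simp add: A_def mult.assoc PPB P)
    also have "\<dots> = Q * Q'" by (simp only: B(3) distrib_right PJ mult_1_left) (simp add: J_eq)
    finally show ?thesis by (simp add: RR)
  qed
  define X where "X = Bi * P"
  have X: "sa X" unfolding X_def using B(2) P(1) PB by (intro sa_mult) auto
  have AX: "A * X = P" "X * A = P" by (simp_all add: A_def X_def mult.assoc PPB PP P BB)
  have mp: "is_mp_inverse inn (ap A) (ap X)"
    unfolding is_mp_inverse_ap[OF pos_sa[OF A] X] AX
    using P(1) by (simp add: A_def X_def P PPB PB)
  have one: "sc 1 = 1" by simp
  obtain Z where Z: "pos Z" "Z * (A + 1) = 1" "(A + 1) * Z = 1"
    using pos_shift_inverse[OF A, of 1] unfolding one by (metis zero_less_one)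
  have sP: "supp_proj inn (ap Q) = ap (scaleR (1/2) ((A + R') * X * Z * (A + R)))"
  proof -
    have "(\<lambda>x. scaleC 2 (range_proj inn (ap Q) x) - ap Q x) = ap R"
      by (auto simp: rP R_def clin_ap scaleC_two)
    then show ?thesis
      unfolding supp_proj_def using matched_proj_ap[OF R A AA X mp pos_sa[OF Z(1)] Z(2,3)] by simp
  qed
  \<comment> \<open>\<open>F + 1 = 2 * (B * B + B)\<close> is invertible on the whole module and
    agrees on the range of \<open>P\<close> with \<open>W * W' = 2 * A * (A + 1)\<close>. This form
    of \<open>F\<close> is visibly positive, so \<open>F + 1\<close> has an invertible root
    \<open>K\<close>.\<close>
  define F where "F = J + B + (J + B) + 1"
  have F: "pos F" unfolding F_def using J B(1) pos_sc[of 1] by (intro pos_add) auto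
  obtain K L where K: "pos K" "sa L" "K * K = F + 1" "K * L = 1" "L * K = 1" "bicomm F K" "bicomm F L"
    using pos_shift_sqrt_inverse[OF F] .
  have "P * F = F * P" by (simp add: F_def algebra_simps PJ PB)
  then have PL: "P * L = L * P" by (rule bicommD[OF K(7) P(1)])
  have F2: "F + 1 = scaleR 2 (J + 1 + B)" by (simp add: F_def scaleR_2)
  have FP: "(F + 1) * P = scaleR 2 (Q * Q' + A)"
    unfolding F2 by (simp add: A_def J_eq algebra_simps P PP Q'P)
  define W where "W = A + R"
  define W' where "W' = A + R'"
  have W: "has_adj W' W"
    unfolding W_def W'_def using pos_sa[OF A] has_adj_sym[OF R] by (rule has_adj_add)
  have "R * A = A" by (simp add: A_def RP flip: PB mult.assoc)
  moreover have "A * R' = A" by (simp add: A_def mult.assoc PR')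
  ultimately have WW: "W * W' = (F + 1) * P"
    unfolding FP by (simp add: W_def W'_def algebra_simps AA RR scaleR_2)
  \<comment> \<open>The polar part of \<open>W'\<close>: on the range of \<open>P\<close>, where
    \<open>W * W'\<close> is \<open>K * K\<close>, the factor \<open>L\<close> inverts the
    root.\<close>
  define V where "V = W' * (L * P)"
  define V' where "V' = P * L * W"
  have V: "has_adj V V'"
    unfolding V_def V'_def using has_adj_mult[OF W has_adj_mult[OF K(2) P(1)]] by (simp add: mult.assoc)
  have "V' * V = P * (L * ((W * W') * (L * P)))" by (simp add: V_def V'_def mult.assoc)
  also have "\<dots> = P * ((L * K) * (K * L)) * P"
    unfolding WW K(3)[symmetric] by (simp add: mult.assoc PL P PP flip: PL)
  also have "\<dots> = P" by (simp add: K P)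
  finally have V'V: "V' * V = P" .
  have LF: "L * L * (F + 1) = 1"
  proof -
    have "L * L * (F + 1) = L * ((L * K) * K)" by (simp only: K(3)[symmetric] mult.assoc)
    then show ?thesis by (simp add: K(5))
  qed
  \<comment> \<open>The two middle factors of the matched projection, with the factor 1/2, are the
    inverse of \<open>W * W'\<close> on the range of \<open>P\<close>; this turns the defining
    formula into \<open>V * V'\<close>.\<close>
  have "scaleR (1/2) (X * Z) = L * L * P"
  proof -
    have "(F + 1) * X = scaleR 2 ((B + 1) * P)"
      unfolding F2 B(3)[symmetric] by (simp add: X_def distrib_right distrib_left mult.assoc BB)
    also have "(B + 1) * P = P * (A + 1)" by (simp add: A_def algebra_simps PPB P)
    finally have "(F + 1) * (scaleR (1/2) (X * Z)) = P"
      by (simp add: mult.assoc Z(3) flip: mult.assoc[of "F + 1"])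
    then have "L * L * (F + 1) * (scaleR (1/2) (X * Z)) = L * L * P" by (simp only: mult.assoc)
    then show ?thesis by (simp only: LF mult_1_left)
  qed
  moreover have "V * V' = W' * (L * L * P) * W"
    by (simp add: V_def V'_def mult.assoc PP) (metis PL mult.assoc)
  moreover have "scaleR (1/2) (W' * X * Z * W) = W' * (scaleR (1/2) (X * Z)) * W"
    by (simp add: mult.assoc)
  ultimately have "supp_proj inn (ap Q) = ap (V * V')"
    unfolding sP W_def[symmetric] W'_def[symmetric] by simp
  moreover have "V * P = V" by (simp add: V_def mult.assoc P)
  ultimately show ?thesis using that rP V V'V by blast
qed

end

theorem theorem5p2:
  fixes act :: "'h::cplx_vector \<Rightarrow> 'a::cstar_algebra \<Rightarrow> 'h"
    and inn :: "'h \<Rightarrow> 'h \<Rightarrow> 'a"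
    and Q :: "'h \<Rightarrow> 'h"
  assumes "hilbert_cstar_module act inn"
    and "adjointable inn Q"
    and "Q \<circ> Q = Q"
  shows "\<exists>T V. adjointable inn T \<and> adjointable inn V
           \<and> (\<exists>X. is_mp_inverse inn T X)
           \<and> supp_proj inn Q = T \<circ> mp_inv inn T
           \<and> supp_proj inn Q = V \<circ> adj inn V
           \<and> range_proj inn Q = mp_inv inn T \<circ> T
           \<and> range_proj inn Q = adj inn V \<circ> V"
proof -
  interpret hilbert_cstar_module act inn by fact
  obtain S S' where S: "Q = ap S" "has_adj S S'" using adjointableE[OF assms(2)] .
  have "S * S = S" using assms(3) by (simp add: S(1) ap_comp ap_inject)
  then obtain P V V' where V: "range_proj inn Q = ap P" "supp_proj inn Q = ap (V * V')"
    "has_adj V V'" "V' * V = P" "V * P = V"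
    using supp_proj_polar[OF S(2)] unfolding S(1) by blast
  have V': "has_adj V' V" using V(3) by (rule has_adj_sym)
  \<comment> \<open>The adjoint of \<open>V * P = V\<close>. Together with \<open>V' * V = P\<close>
    these equations make \<open>V'\<close> the Moore-Penrose inverse of \<open>V\<close>, so
    \<open>ap V\<close> is the witness for both \<open>T\<close> and \<open>V\<close>.\<close>
  have "P * V' = V'"
    using V(3-5) has_adj_mult[OF V(3) has_adj_mult[OF V' V(3)]] has_adj_unique by metis
  then have mp: "is_mp_inverse inn (ap V) (ap V')"
    unfolding is_mp_inverse_ap[OF V(3) V']
    using has_adj_mult[OF V(3) V'] has_adj_mult[OF V' V(3)] V(4,5) by (simp add: mult.assoc)
  have "mp_inv inn (ap V) = ap V'" using V(3) V' mp by (rule mp_inv_ap)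
  with adj_ap[OF V(3)] adjointable_ap[OF V(3)] mp V(1,2,4) show ?thesis
    by (intro exI[of _ "ap V"]) (auto simp: ap_comp)
qed

end
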